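(* Let $(M,g,S(TM))$ be a lightlike hypersurface of an indefinite almost contact metric manifold $(\bar M,\bar\phi,\zeta,\eta,\bar g)$, with $S(TM)$, $\xi$, $N$, $a$, $b$, $D'$ and $W'$ as in the context. Then $\zeta$ (along $M$) takes exactly one of the following forms: (1) $\zeta=a\xi+bN$, i.e. $M$ is an ascreen hypersurface; (2) $\zeta=W'+a\xi+bN$, where $W'$ is a non-zero section of $D'$.
   Context: An indefinite almost contact metric manifold is an odd-dimensional semi-Riemannian manifold $(\bar M,\bar g)$ ($\bar g$ indefinite) with a $(1,1)$ tensor field $\bar\phi$, a vector field $\zeta$ (structure vector field) and a 1-form $\eta$ such that $\eta(\zeta)=1$, $\bar\phi^2=-I+\eta\otimes\zeta$ and $\bar g(\bar\phi X,\bar\phi Y)=\bar g(X,Y)-\eta(X)\eta(Y)$ for all $X,Y$ tangent to $\bar M$. (Consequently $\bar\phi\zeta=0$, $\eta\circ\bar\phi=0$, $\eta(X)=\bar g(X,\zeta)$ and $\bar\phi$ is skew-symmetric with respect to $\bar g$.) A hypersurface $M$ of $\bar M$ with $g=\bar g|_M$ is lightlike if $TM^\perp$ is a rank 1 vector subbundle of $TM$. A screen distribution $S(TM)$ is a (non-degenerate) complement of $TM^\perp$ in $TM$, so $TM=S(TM)\perp TM^\perp$. For a non-zero local section $\xi$ of $TM^\perp$ there is a unique transversal section $N$ with $\bar g(\xi,N)=1$ and $\bar g(N,N)=\bar g(N,Z)=0$ for all $Z\in S(TM)$; it spans the lightlike transversal bundle $\mathrm{tr}(TM)$, and $T\bar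 M|_M=S(TM)\perp\{TM^\perp\oplus\mathrm{tr}(TM)\}$. Write $\zeta=W+a\xi+bN$ along $M$ with $W$ a section of $S(TM)$; then $a=\eta(N)$ and $b=\eta(\xi)$. Standing conventions: the screen distribution is chosen so that $\bar\phi\xi$ is tangent to $S(TM)$ (then $\bar\phi N$ is also tangent to $S(TM)$), and $D'$ is the non-degenerate distribution with $S(TM)=\{\bar\phi TM^\perp+\bar\phi\,\mathrm{tr}(TM)\}\perp D'$ (orthogonal direct sum). Accordingly $W=W'+f_1\bar\phi N+f_2\bar\phi\xi$ with $W'$ a section of $D'$ (the $D'$-component of $W$) and $f_1,f_2$ smooth functions. $M$ is called ascreen if $\zeta$ belongs to $S(TM)^\perp=TM^\perp\oplus\mathrm{tr}(TM)$. *)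

theory Defs
  imports "HOL-Analysis.Analysis" "HOL-Library.Function_Algebras"
begin

text \<open>Pointwise real vector space structure on functions: it makes tangent vectors, which are
  families of components indexed by charts, available to \<open>subspace\<close>, \<open>span\<close> and \<open>dim\<close>.\<close>

instantiation "fun" :: (type, real_vector) real_vector
begin

definition scaleR_fun :: "real \<Rightarrow> ('a \<Rightarrow> 'b) \<Rightarrow> 'a \<Rightarrow> 'b"
  where "scaleR_fun r f = (\<lambda>x. r *\<^sub>R f x)"

instance
  by standard (auto simp: scaleR_fun_def fun_eq_iff scaleR_add_right scaleR_add_left)

end


section \<open>Smooth manifolds\<close>

text \<open>\<open>Ck_on n S f\<close>: the map \<open>f\<close> is of class \<open>C\<^sup>n\<close> on the open set \<open>S\<close>.\<close>

primrec Ck_on :: "nat \<Rightarrow> 'a::euclidean_space set \<Rightarrow> ('a \<Rightarrow> 'b::real_normed_vector) \<Rightarrow> bool"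
  where
    "Ck_on 0 S f \<longleftrightarrow> continuous_on S f"
  | "Ck_on (Suc n) S f \<longleftrightarrow> (\<forall>x\<in>S. f differentiable (at x)) \<and>
       (\<forall>v. Ck_on n S (\<lambda>x. frechet_derivative f (at x) v))"

definition smooth_on :: "'a::euclidean_space set \<Rightarrow> ('a \<Rightarrow> 'b::real_normed_vector) \<Rightarrow> bool"
  where "smooth_on S f \<longleftrightarrow> (\<forall>n. Ck_on n S f)"

type_synonym ('m, 'e) chart = "'m set \<times> ('m \<Rightarrow> 'e)"

definition is_chart :: "('m::topological_space, 'e::euclidean_space) chart \<Rightarrow> bool"
  where "is_chart c \<longleftrightarrow> open (fst c) \<and> open (snd c ` fst c) \<and>
    homeomorphism (fst c) (snd c ` fst c) (snd c) (inv_into (fst c) (snd c))"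

definition chart_inv :: "('m, 'e) chart \<Rightarrow> 'e \<Rightarrow> 'm"
  where "chart_inv c = inv_into (fst c) (snd c)"

definition smooth_atlas :: "('m::{t2_space, second_countable_topology}, 'e::euclidean_space) chart set \<Rightarrow> bool"
  where "smooth_atlas A \<longleftrightarrow> (\<forall>c\<in>A. is_chart c) \<and>
    (\<forall>c\<in>A. \<forall>c'\<in>A. smooth_on (snd c ` (fst c \<inter> fst c')) (snd c' \<circ> chart_inv c))"

text \<open>The manifold described by an atlas is the union of its chart domains, an open subset of
  the ambient type.\<close>

definition carrier :: "('m, 'e) chart set \<Rightarrow> 'm set"
  where "carrier A = (\<Union>c\<in>A. fst c)"

text \<open>A tangent vector at \<open>p\<close> assigns to every chart around \<open>p\<close> its component vector, and the
  components transform under a change of chart by the derivative of the transition map.\<close>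

type_synonym ('m, 'e) tvec = "('m, 'e) chart \<Rightarrow> 'e"

definition tangent_space :: "('m, 'e::euclidean_space) chart set \<Rightarrow> 'm \<Rightarrow> ('m, 'e) tvec set"
  where "tangent_space A p = {v.
    (\<forall>c. c \<notin> A \<or> p \<notin> fst c \<longrightarrow> v c = 0) \<and>
    (\<forall>c\<in>A. \<forall>c'\<in>A. p \<in> fst c \<inter> fst c' \<longrightarrow>
       v c' = frechet_derivative (snd c' \<circ> chart_inv c) (at (snd c p)) (v c))}"

text \<open>\<open>coord_vec A c p u\<close> is the tangent vector at \<open>p\<close> with components \<open>u\<close> in the chart \<open>c\<close>; for
  \<open>u\<close> in the standard basis these are the coordinate vector fields of \<open>c\<close>.\<close>

definition coord_vec :: "('m, 'e::euclidean_space) chart set \<Rightarrow> ('m, 'e) chart \<Rightarrow> 'm \<Rightarrow> 'e \<Rightarrow> ('m, 'e) tvec"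
  where "coord_vec A c p u = (\<lambda>c'. if c' \<in> A \<and> p \<in> fst c'
    then frechet_derivative (snd c' \<circ> chart_inv c) (at (snd c p)) u else 0)"

definition smooth_map ::
  "('n::topological_space, 'f::euclidean_space) chart set \<Rightarrow>
   ('m::topological_space, 'e::euclidean_space) chart set \<Rightarrow> ('n \<Rightarrow> 'm) \<Rightarrow> bool"
  where "smooth_map B A f \<longleftrightarrow> continuous_on (carrier B) f \<and> f ` carrier B \<subseteq> carrier A \<and>
    (\<forall>c\<in>B. \<forall>c'\<in>A. smooth_on (snd c ` (fst c \<inter> f -` fst c')) (snd c' \<circ> f \<circ> chart_inv c))"

text \<open>The choice of the chart \<open>c\<close> is immaterial for smooth \<open>f\<close>, by the chain rule.\<close>

definition differential ::
  "('n, 'f::euclidean_space) chart set \<Rightarrow> ('m, 'e::euclidean_space) chart set \<Rightarrow> ('n \<Rightarrow> 'm) \<Rightarrow>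
   'n \<Rightarrow> ('n, 'f) tvec \<Rightarrow> ('m, 'e) tvec"
  where "differential B A f p v = (\<lambda>c'. if c' \<in> A \<and> f p \<in> fst c'
    then let c = (SOME c. c \<in> B \<and> p \<in> fst c)
         in frechet_derivative (snd c' \<circ> f \<circ> chart_inv c) (at (snd c p)) (v c)
    else 0)"

definition immersion ::
  "('n::topological_space, 'f::euclidean_space) chart set \<Rightarrow>
   ('m::topological_space, 'e::euclidean_space) chart set \<Rightarrow> ('n \<Rightarrow> 'm) \<Rightarrow> bool"
  where "immersion B A f \<longleftrightarrow> smooth_map B A f \<and>
    (\<forall>p\<in>carrier B. inj_on (differential B A f p) (tangent_space B p))"

text \<open>Smooth sections over \<open>V\<close> of the pullback of the tangent bundle of \<open>A\<close> along \<open>f\<close>, i.e. vector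
  fields along \<open>f\<close>. Ordinary vector fields are the case where \<open>f\<close> is the identity.\<close>

definition smooth_section ::
  "('n, 'f::euclidean_space) chart set \<Rightarrow> ('m, 'e::euclidean_space) chart set \<Rightarrow> ('n \<Rightarrow> 'm) \<Rightarrow>
   'n set \<Rightarrow> ('n \<Rightarrow> ('m, 'e) tvec) \<Rightarrow> bool"
  where "smooth_section B A f V X \<longleftrightarrow> (\<forall>p\<in>V. X p \<in> tangent_space A (f p)) \<and>
    (\<forall>c\<in>B. \<forall>c'\<in>A. smooth_on (snd c ` (fst c \<inter> V \<inter> f -` fst c')) (\<lambda>x. X (chart_inv c x) c'))"

definition vector_field :: "('m, 'e::euclidean_space) chart set \<Rightarrow> ('m \<Rightarrow> ('m, 'e) tvec) \<Rightarrow> bool"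
  where "vector_field A X \<longleftrightarrow> smooth_section A A (\<lambda>p. p) (carrier A) X"

text \<open>Vector subbundles of rank \<open>r\<close> of the pullback of the tangent bundle of \<open>A\<close> along \<open>f\<close>.\<close>

definition subbundle ::
  "('n::topological_space, 'f::euclidean_space) chart set \<Rightarrow> ('m, 'e::euclidean_space) chart set \<Rightarrow>
   ('n \<Rightarrow> 'm) \<Rightarrow> nat \<Rightarrow> ('n \<Rightarrow> ('m, 'e) tvec set) \<Rightarrow> bool"
  where "subbundle B A f r E \<longleftrightarrow>
    (\<forall>p\<in>carrier B. subspace (E p) \<and> E p \<subseteq> tangent_space A (f p) \<and> dim (E p) = r) \<and>
    (\<forall>p\<in>carrier B. \<exists>V X. open V \<and> p \<in> V \<and> V \<subseteq> carrier B \<and>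
       (\<forall>j<r. smooth_section B A f V (X j)) \<and>
       (\<forall>q\<in>V. E q = span ((\<lambda>j::nat. X j q) ` {..<r})))"


section \<open>Tensor fields and almost contact metric structures\<close>

definition linear_within :: "'a::real_vector set \<Rightarrow> ('a \<Rightarrow> 'b::real_vector) \<Rightarrow> bool"
  where "linear_within T F \<longleftrightarrow> (\<forall>x\<in>T. \<forall>y\<in>T. F (x + y) = F x + F y) \<and>
    (\<forall>x\<in>T. \<forall>r. F (r *\<^sub>R x) = r *\<^sub>R F x)"

definition one_form ::
  "('m, 'e::euclidean_space) chart set \<Rightarrow> ('m \<Rightarrow> ('m, 'e) tvec \<Rightarrow> real) \<Rightarrow> bool"
  where "one_form A \<eta> \<longleftrightarrow> (\<forall>p\<in>carrier A. linear_within (tangent_space A p) (\<eta> p)) \<and>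
    (\<forall>c\<in>A. \<forall>u. smooth_on (snd c ` fst c) (\<lambda>x. \<eta> (chart_inv c x) (coord_vec A c (chart_inv c x) u)))"

definition tensor_field_1_1 ::
  "('m, 'e::euclidean_space) chart set \<Rightarrow> ('m \<Rightarrow> ('m, 'e) tvec \<Rightarrow> ('m, 'e) tvec) \<Rightarrow> bool"
  where "tensor_field_1_1 A \<phi> \<longleftrightarrow>
    (\<forall>p\<in>carrier A. linear_within (tangent_space A p) (\<phi> p) \<and>
       \<phi> p ` tangent_space A p \<subseteq> tangent_space A p) \<and>
    (\<forall>c\<in>A. \<forall>u. smooth_on (snd c ` fst c) (\<lambda>x. \<phi> (chart_inv c x) (coord_vec A c (chart_inv c x) u) c))"

definition nondegenerate_on :: "('v::real_vector \<Rightarrow> 'v \<Rightarrow> real) \<Rightarrow> 'v set \<Rightarrow> bool"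
  where "nondegenerate_on h E \<longleftrightarrow> (\<forall>x\<in>E. (\<forall>y\<in>E. h x y = 0) \<longrightarrow> x = 0)"

text \<open>The index of a form is the largest dimension of a negative definite subspace.\<close>

definition has_index :: "('v::real_vector \<Rightarrow> 'v \<Rightarrow> real) \<Rightarrow> 'v set \<Rightarrow> nat \<Rightarrow> bool"
  where "has_index h T \<nu> \<longleftrightarrow>
    (\<exists>L. subspace L \<and> L \<subseteq> T \<and> (\<forall>x\<in>L. x \<noteq> 0 \<longrightarrow> h x x < 0) \<and> dim L = \<nu>) \<and>
    (\<forall>L. subspace L \<and> L \<subseteq> T \<and> (\<forall>x\<in>L. x \<noteq> 0 \<longrightarrow> h x x < 0) \<longrightarrow> dim L \<le> \<nu>)"

definition indefinite_metric ::
  "('m, 'e::euclidean_space) chart set \<Rightarrow> ('m \<Rightarrow> ('m, 'e) tvec \<Rightarrow> ('m, 'e) tvec \<Rightarrow> real) \<Rightarrow> bool"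
  where "indefinite_metric A g \<longleftrightarrow>
    (\<forall>p\<in>carrier A.
       (\<forall>x\<in>tangent_space A p. linear_within (tangent_space A p) (g p x)) \<and>
       (\<forall>x\<in>tangent_space A p. \<forall>y\<in>tangent_space A p. g p x y = g p y x) \<and>
       nondegenerate_on (g p) (tangent_space A p)) \<and>
    (\<forall>c\<in>A. \<forall>u w. smooth_on (snd c ` fst c)
       (\<lambda>x. g (chart_inv c x) (coord_vec A c (chart_inv c x) u) (coord_vec A c (chart_inv c x) w))) \<and>
    (\<exists>\<nu>. 0 < \<nu> \<and> \<nu> < DIM('e) \<and> (\<forall>p\<in>carrier A. has_index (g p) (tangent_space A p) \<nu>))"

definition indefinite_almost_contact_metric ::
  "('m::{t2_space, second_countable_topology}, 'e::euclidean_space) chart set \<Rightarrow>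
   ('m \<Rightarrow> ('m, 'e) tvec \<Rightarrow> ('m, 'e) tvec) \<Rightarrow> ('m \<Rightarrow> ('m, 'e) tvec) \<Rightarrow>
   ('m \<Rightarrow> ('m, 'e) tvec \<Rightarrow> real) \<Rightarrow> ('m \<Rightarrow> ('m, 'e) tvec \<Rightarrow> ('m, 'e) tvec \<Rightarrow> real) \<Rightarrow> bool"
  where "indefinite_almost_contact_metric A \<phi> \<zeta> \<eta> g \<longleftrightarrow>
    smooth_atlas A \<and> odd (DIM('e)) \<and> indefinite_metric A g \<and>
    tensor_field_1_1 A \<phi> \<and> vector_field A \<zeta> \<and> one_form A \<eta> \<and>
    (\<forall>p\<in>carrier A. \<eta> p (\<zeta> p) = 1 \<and>
       (\<forall>x\<in>tangent_space A p. \<phi> p (\<phi> p x) = - x + \<eta> p x *\<^sub>R \<zeta> p) \<and>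
       (\<forall>x\<in>tangent_space A p. \<forall>y\<in>tangent_space A p.
          g p (\<phi> p x) (\<phi> p y) = g p x y - \<eta> p x * \<eta> p y))"


section \<open>Lightlike hypersurfaces\<close>

text \<open>A hypersurface of \<open>A\<close> is a manifold \<open>B\<close> with an immersion \<open>f\<close> of codimension one. All bundles
  over it are regarded as subbundles of the pullback of the tangent bundle of \<open>A\<close>, and the induced
  metric at \<open>p\<close> is the restriction of \<open>g (f p)\<close> to \<open>TM B A f p\<close>.\<close>

definition TM ::
  "('n, 'f::euclidean_space) chart set \<Rightarrow> ('m, 'e::euclidean_space) chart set \<Rightarrow> ('n \<Rightarrow> 'm) \<Rightarrow>
   'n \<Rightarrow> ('m, 'e) tvec set"
  where "TM B A f p = differential B A f p ` tangent_space B p"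

definition hypersurface ::
  "('n::{t2_space, second_countable_topology}, 'f::euclidean_space) chart set \<Rightarrow>
   ('m::{t2_space, second_countable_topology}, 'e::euclidean_space) chart set \<Rightarrow> ('n \<Rightarrow> 'm) \<Rightarrow> bool"
  where "hypersurface B A f \<longleftrightarrow> smooth_atlas B \<and> immersion B A f \<and> DIM('e) = DIM('f) + 1"

definition orth :: "('v \<Rightarrow> 'v \<Rightarrow> real) \<Rightarrow> 'v set \<Rightarrow> 'v set \<Rightarrow> 'v set"
  where "orth h T E = {x\<in>T. \<forall>y\<in>E. h x y = 0}"

definition TM_perp ::
  "('n, 'f::euclidean_space) chart set \<Rightarrow> ('m, 'e::euclidean_space) chart set \<Rightarrow>
   ('m \<Rightarrow> ('m, 'e) tvec \<Rightarrow> ('m, 'e) tvec \<Rightarrow> real) \<Rightarrow> ('n \<Rightarrow> 'm) \<Rightarrow> 'n \<Rightarrow> ('m, 'e) tvec set"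
  where "TM_perp B A g f p = orth (g (f p)) (tangent_space A (f p)) (TM B A f p)"

definition lightlike_hypersurface ::
  "('n::{t2_space, second_countable_topology}, 'f::euclidean_space) chart set \<Rightarrow>
   ('m::{t2_space, second_countable_topology}, 'e::euclidean_space) chart set \<Rightarrow>
   ('m \<Rightarrow> ('m, 'e) tvec \<Rightarrow> ('m, 'e) tvec \<Rightarrow> real) \<Rightarrow> ('n \<Rightarrow> 'm) \<Rightarrow> bool"
  where "lightlike_hypersurface B A g f \<longleftrightarrow> hypersurface B A f \<and>
    subbundle B A f 1 (TM_perp B A g f) \<and>
    (\<forall>p\<in>carrier B. TM_perp B A g f p \<subseteq> TM B A f p)"

definition sum_space :: "'v::plus set \<Rightarrow> 'v set \<Rightarrow> 'v set"
  where "sum_space E F = {x + y | x y. x \<in> E \<and> y \<in> F}"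

definition orth_direct_sum :: "('v::real_vector \<Rightarrow> 'v \<Rightarrow> real) \<Rightarrow> 'v set \<Rightarrow> 'v set \<Rightarrow> 'v set \<Rightarrow> bool"
  where "orth_direct_sum h G E F \<longleftrightarrow>
    G = sum_space E F \<and> E \<inter> F = {0} \<and> (\<forall>x\<in>E. \<forall>y\<in>F. h x y = 0)"

text \<open>The component in \<open>E\<close> of a vector of the direct sum of \<open>E\<close> and \<open>F\<close>.\<close>

definition component :: "'v::group_add set \<Rightarrow> 'v set \<Rightarrow> 'v \<Rightarrow> 'v"
  where "component E F v = (THE x. x \<in> E \<and> (\<exists>y\<in>F. v = x + y))"

definition screen_distribution ::
  "('n::topological_space, 'f::euclidean_space) chart set \<Rightarrow>
   ('m, 'e::euclidean_space) chart set \<Rightarrow>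
   ('m \<Rightarrow> ('m, 'e) tvec \<Rightarrow> ('m, 'e) tvec \<Rightarrow> real) \<Rightarrow> ('n \<Rightarrow> 'm) \<Rightarrow> ('n \<Rightarrow> ('m, 'e) tvec set) \<Rightarrow> bool"
  where "screen_distribution B A g f S \<longleftrightarrow> (\<exists>r. subbundle B A f r S) \<and>
    (\<forall>p\<in>carrier B. nondegenerate_on (g (f p)) (S p) \<and>
       orth_direct_sum (g (f p)) (TM B A f p) (S p) (TM_perp B A g f p))"

text \<open>The vector \<open>n\<close> is the transversal vector associated with the normal vector \<open>x\<close> at \<open>p\<close>.\<close>

definition transversal_vec ::
  "('m, 'e::euclidean_space) chart set \<Rightarrow>
   ('m \<Rightarrow> ('m, 'e) tvec \<Rightarrow> ('m, 'e) tvec \<Rightarrow> real) \<Rightarrow> ('n \<Rightarrow> 'm) \<Rightarrow> ('n \<Rightarrow> ('m, 'e) tvec set) \<Rightarrow>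
   'n \<Rightarrow> ('m, 'e) tvec \<Rightarrow> ('m, 'e) tvec \<Rightarrow> bool"
  where "transversal_vec A g f S p x n \<longleftrightarrow> n \<in> tangent_space A (f p) \<and>
    g (f p) x n = 1 \<and> g (f p) n n = 0 \<and> (\<forall>z\<in>S p. g (f p) n z = 0)"

definition tr_TM ::
  "('n, 'f::euclidean_space) chart set \<Rightarrow> ('m, 'e::euclidean_space) chart set \<Rightarrow>
   ('m \<Rightarrow> ('m, 'e) tvec \<Rightarrow> ('m, 'e) tvec \<Rightarrow> real) \<Rightarrow> ('n \<Rightarrow> 'm) \<Rightarrow> ('n \<Rightarrow> ('m, 'e) tvec set) \<Rightarrow>
   'n \<Rightarrow> ('m, 'e) tvec set"
  where "tr_TM B A g f S p = span {n. \<exists>x\<in>TM_perp B A g f p. x \<noteq> 0 \<and> transversal_vec A g f S p x n}"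

text \<open>Local pairs: a nowhere zero section \<open>\<xi>\<close> of \<open>TM_perp\<close> over the open set \<open>V\<close> and the associated
  transversal section \<open>N\<close>.\<close>

definition null_pair ::
  "('n::topological_space, 'f::euclidean_space) chart set \<Rightarrow> ('m, 'e::euclidean_space) chart set \<Rightarrow>
   ('m \<Rightarrow> ('m, 'e) tvec \<Rightarrow> ('m, 'e) tvec \<Rightarrow> real) \<Rightarrow> ('n \<Rightarrow> 'm) \<Rightarrow> ('n \<Rightarrow> ('m, 'e) tvec set) \<Rightarrow>
   'n set \<Rightarrow> ('n \<Rightarrow> ('m, 'e) tvec) \<Rightarrow> ('n \<Rightarrow> ('m, 'e) tvec) \<Rightarrow> bool"
  where "null_pair B A g f S V \<xi> N \<longleftrightarrow> open V \<and> V \<subseteq> carrier B \<and>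
    smooth_section B A f V \<xi> \<and> smooth_section B A f V N \<and>
    (\<forall>p\<in>V. \<xi> p \<in> TM_perp B A g f p \<and> \<xi> p \<noteq> 0 \<and> transversal_vec A g f S p (\<xi> p) (N p))"

definition phi_part ::
  "('n, 'f::euclidean_space) chart set \<Rightarrow> ('m, 'e::euclidean_space) chart set \<Rightarrow>
   ('m \<Rightarrow> ('m, 'e) tvec \<Rightarrow> ('m, 'e) tvec) \<Rightarrow>
   ('m \<Rightarrow> ('m, 'e) tvec \<Rightarrow> ('m, 'e) tvec \<Rightarrow> real) \<Rightarrow> ('n \<Rightarrow> 'm) \<Rightarrow> ('n \<Rightarrow> ('m, 'e) tvec set) \<Rightarrow>
   'n \<Rightarrow> ('m, 'e) tvec set"
  where "phi_part B A \<phi> g f S p =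
    sum_space (\<phi> (f p) ` TM_perp B A g f p) (\<phi> (f p) ` tr_TM B A g f S p)"

text \<open>The first conjunct is the convention that \<open>\<phi> \<xi>\<close> be tangent to the screen distribution.\<close>

definition adapted_screen ::
  "('n::topological_space, 'f::euclidean_space) chart set \<Rightarrow> ('m, 'e::euclidean_space) chart set \<Rightarrow>
   ('m \<Rightarrow> ('m, 'e) tvec \<Rightarrow> ('m, 'e) tvec) \<Rightarrow>
   ('m \<Rightarrow> ('m, 'e) tvec \<Rightarrow> ('m, 'e) tvec \<Rightarrow> real) \<Rightarrow> ('n \<Rightarrow> 'm) \<Rightarrow> ('n \<Rightarrow> ('m, 'e) tvec set) \<Rightarrow>
   ('n \<Rightarrow> ('m, 'e) tvec set) \<Rightarrow> bool"
  where "adapted_screen B A \<phi> g f S D' \<longleftrightarrow>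
    (\<forall>p\<in>carrier B. \<phi> (f p) ` TM_perp B A g f p \<subseteq> S p) \<and>
    (\<exists>r. subbundle B A f r D') \<and>
    (\<forall>p\<in>carrier B. nondegenerate_on (g (f p)) (D' p) \<and>
       orth_direct_sum (g (f p)) (S p) (phi_part B A \<phi> g f S p) (D' p))"

text \<open>The components of the structure vector field in the screen distribution and in \<open>D'\<close>.\<close>

definition W_part ::
  "('n, 'f::euclidean_space) chart set \<Rightarrow> ('m, 'e::euclidean_space) chart set \<Rightarrow>
   ('m \<Rightarrow> ('m, 'e) tvec) \<Rightarrow>
   ('m \<Rightarrow> ('m, 'e) tvec \<Rightarrow> ('m, 'e) tvec \<Rightarrow> real) \<Rightarrow> ('n \<Rightarrow> 'm) \<Rightarrow> ('n \<Rightarrow> ('m, 'e) tvec set) \<Rightarrow>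
   'n \<Rightarrow> ('m, 'e) tvec"
  where "W_part B A \<zeta> g f S p =
    component (S p) (sum_space (TM_perp B A g f p) (tr_TM B A g f S p)) (\<zeta> (f p))"

definition W'_part ::
  "('n, 'f::euclidean_space) chart set \<Rightarrow> ('m, 'e::euclidean_space) chart set \<Rightarrow>
   ('m \<Rightarrow> ('m, 'e) tvec \<Rightarrow> ('m, 'e) tvec) \<Rightarrow> ('m \<Rightarrow> ('m, 'e) tvec) \<Rightarrow>
   ('m \<Rightarrow> ('m, 'e) tvec \<Rightarrow> ('m, 'e) tvec \<Rightarrow> real) \<Rightarrow> ('n \<Rightarrow> 'm) \<Rightarrow> ('n \<Rightarrow> ('m, 'e) tvec set) \<Rightarrow>
   ('n \<Rightarrow> ('m, 'e) tvec set) \<Rightarrow> 'n \<Rightarrow> ('m, 'e) tvec"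
  where "W'_part B A \<phi> \<zeta> g f S D' p =
    component (D' p) (phi_part B A \<phi> g f S p) (W_part B A \<zeta> g f S p)"

definition section_of ::
  "('n, 'f::euclidean_space) chart set \<Rightarrow> ('m, 'e::euclidean_space) chart set \<Rightarrow> ('n \<Rightarrow> 'm) \<Rightarrow>
   ('n \<Rightarrow> ('m, 'e) tvec set) \<Rightarrow> ('n \<Rightarrow> ('m, 'e) tvec) \<Rightarrow> bool"
  where "section_of B A f E X \<longleftrightarrow>
    smooth_section B A f (carrier B) X \<and> (\<forall>p\<in>carrier B. X p \<in> E p)"

definition ascreen ::
  "('n, 'f::euclidean_space) chart set \<Rightarrow> ('m, 'e::euclidean_space) chart set \<Rightarrow>
   ('m \<Rightarrow> ('m, 'e) tvec) \<Rightarrow>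
   ('m \<Rightarrow> ('m, 'e) tvec \<Rightarrow> ('m, 'e) tvec \<Rightarrow> real) \<Rightarrow> ('n \<Rightarrow> 'm) \<Rightarrow> ('n \<Rightarrow> ('m, 'e) tvec set) \<Rightarrow> bool"
  where "ascreen B A \<zeta> g f S \<longleftrightarrow>
    (\<forall>p\<in>carrier B. \<zeta> (f p) \<in> orth (g (f p)) (tangent_space A (f p)) (S p))"

end

theory Submission
  imports Defs
begin

text \<open>Since \<open>\<eta> \<circ> \<phi> = 0\<close> and \<open>\<eta> = g(\<cdot>, \<zeta>)\<close>, the screen component \<open>W\<close> of \<open>\<zeta>\<close> is orthogonal to \<open>\<phi> \<xi>\<close> and
  \<open>\<phi> N\<close>. As the screen is nondegenerate and splits orthogonally into these directions and \<open>D'\<close>, the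
  component of \<open>W\<close> along them vanishes, so \<open>W = W'\<close> and the dichotomy is whether \<open>W'\<close> vanishes
  identically. The analytic content is that orthogonal projection onto a nondegenerate smooth
  subbundle is smooth: its coefficients in a local frame solve a linear system with smooth
  coefficients. This gives both the smoothness of \<open>W'\<close> and the existence of local pairs \<open>\<xi>, N\<close>.\<close>

section \<open>Calculus of smooth maps\<close>

text \<open>\<open>W_part\<close> and \<open>W'_part\<close> are definite descriptions at single
  points, so nothing about them, not even membership in \<open>S p\<close>, is available until a
  decomposition is shown to exist and to be unique; smoothness is read off from a locally
  constructed field with the same characterisation: it lies in \<open>S\<close>, and \<zeta> minus
  it is orthogonal to \<open>S\<close>. Both forms quantify over all local null pairs, so they speak
  about a point only if some pair is defined there: \<open>form1\<close> forces W' = 0 because pairs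
  exist around every point of M. The metric is indefinite, hence a frame of \<open>S\<close> may
  contain null vectors and Gram-Schmidt can break down; nondegeneracy only makes the Gram matrix
  injective, and elimination with a pivot chosen at one point replaces orthonormalisation. The same
  projection produces N: an ambient field pairing nontrivially with \<xi> is made orthogonal to the
  screen, rescaled, and shifted along \<xi> to become null. A non-zero section W' is one that is not
  identically zero, so the second form is the exact negation of the vanishing of W' on all of
  M.\<close>

lemma Ck_on_subset: "Ck_on n S f \<Longrightarrow> T \<subseteq> S \<Longrightarrow> Ck_on n T f"
  by (induction n arbitrary: f) (auto intro: continuous_on_subset)

text \<open>Derivatives \<open>at x\<close> see a full neighbourhood of x, so agreement on S passes
  to them because S is open; the induction then applies to the derivative in each fixed
  direction.\<close>

lemma Ck_on_cong:
  assumes "open S" "\<And>x. x \<in> S \<Longrightarrow> f x = h x" "Ck_on n S f"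
  shows "Ck_on n S h"
  using assms(2,3)
proof (induction n arbitrary: f h)
  case 0
  then show ?case using continuous_on_cong[of S S f h] by simp
next
  case (Suc n)
  have der: "(h has_derivative frechet_derivative f (at x)) (at x)" if "x \<in> S" for x
    by (rule has_derivative_transform_within_open[of f _ x UNIV S])
       (use Suc.prems assms(1) that frechet_derivative_works in auto)
  then have "frechet_derivative h (at x) = frechet_derivative f (at x)" if "x \<in> S" for x
    using that frechet_derivative_at by metis
  then have "Ck_on n S (\<lambda>x. frechet_derivative h (at x) v)" for v
    using Suc.IH[of "\<lambda>x. frechet_derivative f (at x) v"] Suc.prems(2) by simp
  then show ?case
    using der by (auto simp: differentiable_def)
qed

text \<open>Lets each closure rule below name its derivative by a formula: uniqueness of derivatives
  identifies it with \<open>frechet_derivative\<close> on S.\<close>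

lemma Ck_on_SucI:
  assumes "open S" "\<And>x. x \<in> S \<Longrightarrow> (f has_derivative f' x) (at x)" "\<And>v. Ck_on n S (\<lambda>x. f' x v)"
  shows "Ck_on (Suc n) S f"
proof -
  have "frechet_derivative f (at x) = f' x" if "x \<in> S" for x
    using assms(2)[OF that] frechet_derivative_at by metis
  then have "Ck_on n S (\<lambda>x. frechet_derivative f (at x) v)" for v
    using Ck_on_cong[OF assms(1) _ assms(3)] by simp
  then show ?thesis
    using assms(2) by (auto simp: differentiable_def)
qed

lemma Ck_on_Suc_has_derivative:
  "Ck_on (Suc n) S f \<Longrightarrow> x \<in> S \<Longrightarrow> (f has_derivative frechet_derivative f (at x)) (at x)"
  using frechet_derivative_works by auto

lemma Ck_on_SucD: "Ck_on (Suc n) S f \<Longrightarrow> Ck_on n S f"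
proof (induction n arbitrary: f)
  case 0
  then show ?case
    by (simp add: continuous_at_imp_continuous_on differentiable_imp_continuous_within)
next
  case (Suc n)
  then show ?case by (metis Ck_on.simps(2))
qed

lemma Ck_on_local:
  assumes "\<And>x. x \<in> S \<Longrightarrow> \<exists>U. open U \<and> x \<in> U \<and> Ck_on n U f"
  shows "Ck_on n S f"
  using assms
proof (induction n arbitrary: f)
  case 0
  show ?case
  proof (simp, intro continuous_at_imp_continuous_on ballI)
    fix x assume "x \<in> S"
    then show "isCont f x"
      using 0 continuous_on_eq_continuous_at by fastforce
  qed
next
  case (Suc n)
  then show ?case by (force intro!: Suc.IH)
qed

lemma Ck_on_const: "Ck_on n S (\<lambda>x. a)"
  by (induction n arbitrary: a) (auto simp: frechet_derivative_const)

lemma Ck_on_add: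
  assumes "open S" "Ck_on n S f" "Ck_on n S h"
  shows "Ck_on n S (\<lambda>x. f x + h x)"
  using assms(2,3)
proof (induction n arbitrary: f h)
  case 0
  then show ?case by (auto intro: continuous_intros)
next
  case (Suc n)
  show ?case
    by (rule Ck_on_SucI[OF assms(1) has_derivative_add[OF Ck_on_Suc_has_derivative[OF Suc.prems(1)]
          Ck_on_Suc_has_derivative[OF Suc.prems(2)]]])
       (use Suc in auto)
qed

lemma Ck_on_sum:
  assumes "open S" "\<And>i. i \<in> I \<Longrightarrow> Ck_on n S (f i)"
  shows "Ck_on n S (\<lambda>x. \<Sum>i\<in>I. f i x)"
  using assms(2)
  by (induction I rule: infinite_finite_induct) (auto intro: Ck_on_add assms(1) Ck_on_const)

text \<open>The Leibniz rule leaves products of one factor with a derivative of the other; the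
  undifferentiated factor drops from class n+1 to n by \<open>Ck_on_SucD\<close>, so the induction
  hypothesis applies to each product.\<close>

lemma (in bounded_bilinear) Ck_on:
  assumes "open S" "Ck_on n S f" "Ck_on n S h"
  shows "Ck_on n S (\<lambda>x. prod (f x) (h x))"
  using assms(2,3)
proof (induction n arbitrary: f h)
  case 0
  then show ?case by (auto intro: continuous_on)
next
  case (Suc n)
  show ?case
    by (rule Ck_on_SucI[OF assms(1) FDERIV[OF Ck_on_Suc_has_derivative[OF Suc.prems(1)]
          Ck_on_Suc_has_derivative[OF Suc.prems(2)]]])
       (use Suc.prems Ck_on_SucD[OF Suc.prems(1)] Ck_on_SucD[OF Suc.prems(2)] in
         \<open>auto intro!: Ck_on_add[OF assms(1)] Suc.IH\<close>)
qed

lemmas Ck_on_mult = bounded_bilinear.Ck_on[OF bounded_bilinear_mult]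
lemmas Ck_on_scaleR = bounded_bilinear.Ck_on[OF bounded_bilinear_scaleR]
lemmas Ck_on_inner = bounded_bilinear.Ck_on[OF bounded_bilinear_inner]

text \<open>The derivative of 1/f is a product of f' with two copies of 1/f, and 1/f is of class n
  by the induction hypothesis for the same f; hence f stays fixed in the induction.\<close>

lemma Ck_on_inverse:
  fixes f :: "'a::euclidean_space \<Rightarrow> real"
  assumes "open S" "Ck_on n S f" "\<And>x. x \<in> S \<Longrightarrow> f x \<noteq> 0"
  shows "Ck_on n S (\<lambda>x. inverse (f x))"
  using assms(2)
proof (induction n)
  case 0
  then show ?case using assms(3) by (auto intro: continuous_intros)
next
  case (Suc n)
  note IH = Suc.IH[OF Ck_on_SucD[OF Suc.prems]]
  show ?case
  proof (rule Ck_on_SucI[OF assms(1)])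
    show "((\<lambda>x. inverse (f x)) has_derivative
        (\<lambda>v. -1 * (inverse (f x) * (frechet_derivative f (at x) v * inverse (f x))))) (at x)" if "x \<in> S" for x
      using Deriv.has_derivative_inverse[OF assms(3)[OF that] Ck_on_Suc_has_derivative[OF Suc.prems that]]
      by (simp add: mult.assoc)
    show "Ck_on n S (\<lambda>x. -1 * (inverse (f x) * (frechet_derivative f (at x) v * inverse (f x))))" for v
      using IH Suc.prems by (intro Ck_on_mult Ck_on_const assms(1)) auto
  qed
qed

lemma Ck_on_compose:
  fixes h :: "'a::euclidean_space \<Rightarrow> 'b::euclidean_space" and f :: "'b \<Rightarrow> 'c::real_normed_vector"
  assumes "open S" "Ck_on n S h" "Ck_on n T f" "h ` S \<subseteq> T"
  shows "Ck_on n S (\<lambda>x. f (h x))"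
  using assms(2,3)
proof (induction n arbitrary: f)
  case 0
  then show ?case using continuous_on_compose2 assms(4) by auto
next
  case (Suc n)
  \<comment> \<open>The chain rule evaluates the derivative of f in the direction h'(x) v, which
    varies with x, whereas \<open>Ck_on\<close> controls fixed directions only. Expanding in
    \<open>Basis\<close> leaves fixed directions b with coefficients of class n.\<close>
  let ?D = "\<lambda>x v. \<Sum>b\<in>Basis. (frechet_derivative h (at x) v \<bullet> b) *\<^sub>R frechet_derivative f (at (h x)) b"
  show ?case
  proof (rule Ck_on_SucI[OF assms(1)])
    fix x assume x: "x \<in> S"
    have df: "(f has_derivative frechet_derivative f (at (h x))) (at (h x))"
      using Ck_on_Suc_has_derivative Suc.prems(2) x assms(4) by blast
    have "frechet_derivative f (at (h x)) w = (\<Sum>b\<in>Basis. (w \<bullet> b) *\<^sub>R frechet_derivative f (at (h x)) b)" for w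
      by (subst euclidean_representation[of w, symmetric])
         (simp only: linear_sum[OF has_derivative_linear[OF df]] linear_scale[OF has_derivative_linear[OF df]])
    then show "((\<lambda>x. f (h x)) has_derivative ?D x) (at x)"
      using has_derivative_compose[OF Ck_on_Suc_has_derivative[OF Suc.prems(1) x] df]
      by (metis (no_types, lifting) ext)
  next
    fix v
    show "Ck_on n S (\<lambda>x. ?D x v)"
      using Suc.prems
      by (intro Ck_on_sum Ck_on_scaleR Ck_on_inner Ck_on_const assms(1) Suc.IH Ck_on_SucD[OF Suc.prems(1)]) auto
  qed
qed

section \<open>Closure rules passed from the classes C^n to smooth maps\<close>

lemma smooth_on_subset: "smooth_on S f \<Longrightarrow> T \<subseteq> S \<Longrightarrow> smooth_on T f"
  unfolding smooth_on_def using Ck_on_subset by blast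

lemma smooth_on_cong: "open S \<Longrightarrow> (\<And>x. x \<in> S \<Longrightarrow> f x = h x) \<Longrightarrow> smooth_on S f \<Longrightarrow> smooth_on S h"
  unfolding smooth_on_def using Ck_on_cong by blast

lemma smooth_on_local:
  "(\<And>x. x \<in> S \<Longrightarrow> \<exists>U. open U \<and> x \<in> U \<and> smooth_on U f) \<Longrightarrow> smooth_on S f"
  unfolding smooth_on_def by (metis Ck_on_local)

lemma smooth_on_differentiable: "smooth_on S f \<Longrightarrow> x \<in> S \<Longrightarrow> f differentiable (at x)"
  unfolding smooth_on_def by (metis Ck_on.simps(2))

lemma smooth_on_continuous: "smooth_on S f \<Longrightarrow> continuous_on S f"
  unfolding smooth_on_def by (metis Ck_on.simps(1))

lemma smooth_on_frechet_derivative: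
  "smooth_on S f \<Longrightarrow> smooth_on S (\<lambda>x. frechet_derivative f (at x) v)"
  unfolding smooth_on_def by (metis Ck_on.simps(2))

lemma smooth_on_const: "smooth_on S (\<lambda>x. a)"
  unfolding smooth_on_def by (simp add: Ck_on_const)

lemma smooth_on_add: "open S \<Longrightarrow> smooth_on S f \<Longrightarrow> smooth_on S h \<Longrightarrow> smooth_on S (\<lambda>x. f x + h x)"
  unfolding smooth_on_def by (simp add: Ck_on_add)

lemma smooth_on_sum:
  "open S \<Longrightarrow> (\<And>i. i \<in> I \<Longrightarrow> smooth_on S (f i)) \<Longrightarrow> smooth_on S (\<lambda>x. \<Sum>i\<in>I. f i x)"
  unfolding smooth_on_def by (simp add: Ck_on_sum)

lemma smooth_on_mult:
  fixes f h :: "'a::euclidean_space \<Rightarrow> real"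
  shows "open S \<Longrightarrow> smooth_on S f \<Longrightarrow> smooth_on S h \<Longrightarrow> smooth_on S (\<lambda>x. f x * h x)"
  unfolding smooth_on_def by (simp add: Ck_on_mult)

lemma smooth_on_scaleR:
  "open S \<Longrightarrow> smooth_on S f \<Longrightarrow> smooth_on S h \<Longrightarrow> smooth_on S (\<lambda>x. f x *\<^sub>R h x)"
  unfolding smooth_on_def by (simp add: Ck_on_scaleR)

lemma smooth_on_inner:
  "open S \<Longrightarrow> smooth_on S f \<Longrightarrow> smooth_on S h \<Longrightarrow> smooth_on S (\<lambda>x. f x \<bullet> h x)"
  unfolding smooth_on_def by (simp add: Ck_on_inner)

lemma smooth_on_inverse:
  fixes f :: "'a::euclidean_space \<Rightarrow> real"
  shows "open S \<Longrightarrow> smooth_on S f \<Longrightarrow> (\<And>x. x \<in> S \<Longrightarrow> f x \<noteq> 0) \<Longrightarrow> smooth_on S (\<lambda>x. inverse (f x))"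
  unfolding smooth_on_def by (simp add: Ck_on_inverse)

lemma smooth_on_compose:
  fixes h :: "'a::euclidean_space \<Rightarrow> 'b::euclidean_space"
  shows "open S \<Longrightarrow> smooth_on S h \<Longrightarrow> smooth_on T f \<Longrightarrow> h ` S \<subseteq> T \<Longrightarrow> smooth_on S (\<lambda>x. f (h x))"
  unfolding smooth_on_def using Ck_on_compose by blast

section \<open>Charts, transition maps and tangent vectors\<close>

lemma is_chart_open_image:
  assumes "is_chart c" "open U" "U \<subseteq> fst c"
  shows "open (snd c ` U)"
proof -
  have "openin (top_of_set (snd c ` fst c)) (snd c ` U)"
    using assms homeomorphism_imp_open_map[of "fst c" "snd c ` fst c" "snd c"]
    unfolding is_chart_def by (metis openin_open_eq)
  then show ?thesis
    using assms(1) openin_open_trans unfolding is_chart_def by blast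
qed

lemma chart_inv_chart: "is_chart c \<Longrightarrow> q \<in> fst c \<Longrightarrow> chart_inv c (snd c q) = q"
  unfolding is_chart_def chart_inv_def homeomorphism_def by blast

lemma smooth_atlas_transition:
  assumes "smooth_atlas A" "c \<in> A" "c' \<in> A"
  shows "smooth_on (snd c ` (fst c \<inter> fst c')) (\<lambda>x. snd c' (chart_inv c x))"
  using assms unfolding smooth_atlas_def comp_def by blast

lemma smooth_atlas_transition_has_derivative:
  assumes "smooth_atlas A" "c \<in> A" "c' \<in> A" "p \<in> fst c" "p \<in> fst c'"
  shows "(snd c' \<circ> chart_inv c has_derivative
    frechet_derivative (snd c' \<circ> chart_inv c) (at (snd c p))) (at (snd c p))"
  using smooth_on_differentiable[OF smooth_atlas_transition[OF assms(1-3)], of "snd c p"] assms(4,5)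
  by (auto simp: comp_def frechet_derivative_works[symmetric])

text \<open>The change-of-chart law is linear because transition maps are differentiable: this is
  what makes \<open>frechet_derivative\<close> a linear map.\<close>

lemma subspace_tangent_space:
  assumes A: "smooth_atlas A"
  shows "subspace (tangent_space A p)"
proof -
  have lin: "linear (frechet_derivative (snd c' \<circ> chart_inv c) (at (snd c p)))"
    if "c \<in> A" "c' \<in> A" "p \<in> fst c \<inter> fst c'" for c c'
    using smooth_atlas_transition_has_derivative[OF A, of c c' p] that has_derivative_linear by blast
  show ?thesis
    unfolding subspace_def tangent_space_def
    by (intro conjI ballI allI CollectI impI; (elim CollectE conjE)?)
       (simp_all only: zero_fun_apply plus_fun_apply scaleR_fun_def add_0 scaleR_zero_right linear_0[OF lin] linear_add[OF lin] linear_scale[OF lin])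
qed

text \<open>Compatibility of the components in two charts c1 and c2 is the chain rule for the
  transitions from c to c1 to c2.\<close>

lemma coord_vec_in_tangent_space:
  assumes A: "smooth_atlas A" and c: "c \<in> A" "p \<in> fst c"
  shows "coord_vec A c p u \<in> tangent_space A p"
proof -
  have chain: "frechet_derivative (snd c2 \<circ> chart_inv c) (at (snd c p)) u =
     frechet_derivative (snd c2 \<circ> chart_inv c1) (at (snd c1 p))
       (frechet_derivative (snd c1 \<circ> chart_inv c) (at (snd c p)) u)"
    if c1: "c1 \<in> A" "p \<in> fst c1" and c2: "c2 \<in> A" "p \<in> fst c2" for c1 c2
  proof -
    have ch: "is_chart c" "is_chart c1" using A c c1 by (auto simp: smooth_atlas_def)
    let ?O = "snd c ` (fst c \<inter> fst c1)"
    have O: "open ?O" using ch by (intro is_chart_open_image) (auto simp: is_chart_def)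
    have "(snd c2 \<circ> chart_inv c1 has_derivative
        frechet_derivative (snd c2 \<circ> chart_inv c1) (at (snd c1 p))) (at ((snd c1 \<circ> chart_inv c) (snd c p)))"
      using smooth_atlas_transition_has_derivative[OF A c1(1) c2(1) c1(2) c2(2)] chart_inv_chart[OF ch(1) c(2)]
      by simp
    from diff_chain_at[OF smooth_atlas_transition_has_derivative[OF A c(1) c1(1) c(2) c1(2)] this]
    have "((snd c2 \<circ> chart_inv c1) \<circ> (snd c1 \<circ> chart_inv c) has_derivative
      frechet_derivative (snd c2 \<circ> chart_inv c1) (at (snd c1 p)) \<circ>
       frechet_derivative (snd c1 \<circ> chart_inv c) (at (snd c p))) (at (snd c p))" .
    \<comment> \<open>The composite is known to agree with the direct transition only on the image
      of the overlap; that set is open and contains the point, so the derivative carries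
      over.\<close>
    then have "(snd c2 \<circ> chart_inv c has_derivative
      frechet_derivative (snd c2 \<circ> chart_inv c1) (at (snd c1 p)) \<circ>
       frechet_derivative (snd c1 \<circ> chart_inv c) (at (snd c p))) (at (snd c p))"
      by (rule has_derivative_transform_within_open[OF _ O])
         (use c c1 chart_inv_chart[OF ch(1)] chart_inv_chart[OF ch(2)] in auto)
    then show ?thesis
      by (metis comp_apply frechet_derivative_at)
  qed
  show ?thesis
    unfolding tangent_space_def
  proof (intro CollectI conjI allI ballI impI)
    fix c1 c2 assume "c1 \<in> A" "c2 \<in> A" "p \<in> fst c1 \<inter> fst c2"
    then show "coord_vec A c p u c2 =
        frechet_derivative (snd c2 \<circ> chart_inv c1) (at (snd c1 p)) (coord_vec A c p u c1)"
      using chain[of c1 c2] by (simp add: coord_vec_def)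
  qed (auto simp: coord_vec_def)
qed

text \<open>The transformation law from \<open>c\<close> determines the components in all charts
  around p; elsewhere both sides have the default value 0.\<close>

lemma tangent_space_eq_coord_vec:
  "v \<in> tangent_space A p \<Longrightarrow> c \<in> A \<Longrightarrow> p \<in> fst c \<Longrightarrow> v = coord_vec A c p (v c)"
proof
  fix c' assume *: "v \<in> tangent_space A p" "c \<in> A" "p \<in> fst c"
  then have "v c' = 0" if "\<not> (c' \<in> A \<and> p \<in> fst c')"
    using that unfolding tangent_space_def by blast
  moreover have "v c' = frechet_derivative (snd c' \<circ> chart_inv c) (at (snd c p)) (v c)"
    if "c' \<in> A \<and> p \<in> fst c'"
    using that * unfolding tangent_space_def by blast
  ultimately show "v c' = coord_vec A c p (v c) c'"
    unfolding coord_vec_def by presburger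
qed

lemma sum_fun_apply: "(\<Sum>i\<in>I. F i) x = (\<Sum>i\<in>I. F i x)"
  by (induction I rule: infinite_finite_induct) auto

lemma coord_vec_sum_Basis:
  assumes A: "smooth_atlas A" and c: "c \<in> A" "p \<in> fst c"
  shows "coord_vec A c p u = (\<Sum>b\<in>Basis. (u \<bullet> b) *\<^sub>R coord_vec A c p b)"
proof
  fix c'
  show "coord_vec A c p u c' = (\<Sum>b\<in>Basis. (u \<bullet> b) *\<^sub>R coord_vec A c p b) c'"
  proof (cases "c' \<in> A \<and> p \<in> fst c'")
    case True
    then have lin: "linear (frechet_derivative (snd c' \<circ> chart_inv c) (at (snd c p)))"
      using smooth_atlas_transition_has_derivative[OF A c(1) _ c(2)] has_derivative_linear by blast
    have "frechet_derivative (snd c' \<circ> chart_inv c) (at (snd c p)) (\<Sum>b\<in>Basis. (u \<bullet> b) *\<^sub>R b) =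
        (\<Sum>b\<in>Basis. (u \<bullet> b) *\<^sub>R frechet_derivative (snd c' \<circ> chart_inv c) (at (snd c p)) b)"
      by (simp only: linear_sum[OF lin] linear_scale[OF lin])
    then show ?thesis
      using True by (simp add: coord_vec_def sum_fun_apply scaleR_fun_def euclidean_representation)
  next
    case False
    then show ?thesis
      by (auto simp: coord_vec_def sum_fun_apply scaleR_fun_def)
  qed
qed

section \<open>Smooth functions and linear systems\<close>

lemma linear_within_0:
  assumes "subspace T" "linear_within T F"
  shows "F 0 = 0"
proof -
  have "F (0 *\<^sub>R 0) = 0 *\<^sub>R F 0"
    using assms subspace_0 unfolding linear_within_def by blast
  then show ?thesis by simp
qed

lemma linear_within_diff:
  assumes "subspace T" "linear_within T F" "x \<in> T" "y \<in> T"
  shows "F (x - y) = F x - F y"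
proof -
  have "F (x + (-1) *\<^sub>R y) = F x + (-1) *\<^sub>R F y"
    using assms subspace_scale unfolding linear_within_def by metis
  then show ?thesis by simp
qed

lemma linear_within_sum:
  assumes T: "subspace T" and F: "linear_within T F" and "\<And>i. i \<in> I \<Longrightarrow> v i \<in> T"
  shows "F (\<Sum>i\<in>I. a i *\<^sub>R v i) = (\<Sum>i\<in>I. a i *\<^sub>R F (v i))"
  using assms(3)
proof (induction I rule: infinite_finite_induct)
  case (insert i I)
  have "(\<Sum>i\<in>I. a i *\<^sub>R v i) \<in> T"
    using insert.prems T by (intro subspace_sum subspace_scale) auto
  moreover have "a i *\<^sub>R v i \<in> T"
    using insert.prems T by (auto intro: subspace_scale)
  ultimately have "F (a i *\<^sub>R v i + (\<Sum>i\<in>I. a i *\<^sub>R v i)) = F (a i *\<^sub>R v i) + F (\<Sum>i\<in>I. a i *\<^sub>R v i)"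
    using F unfolding linear_within_def by blast
  moreover have "F (a i *\<^sub>R v i) = a i *\<^sub>R F (v i)"
    using F insert.prems unfolding linear_within_def by blast
  ultimately show ?case
    using insert by simp
qed (use linear_within_0[OF T F] in auto)

definition smooth_fun :: "('n, 'f::euclidean_space) chart set \<Rightarrow> 'n set \<Rightarrow> ('n \<Rightarrow> real) \<Rightarrow> bool"
  where "smooth_fun B V h \<longleftrightarrow> (\<forall>c\<in>B. smooth_on (snd c ` (fst c \<inter> V)) (\<lambda>x. h (chart_inv c x)))"

lemma smooth_fun_subset: "smooth_fun B V h \<Longrightarrow> U \<subseteq> V \<Longrightarrow> smooth_fun B U h"
  unfolding smooth_fun_def by (meson Int_mono image_mono order_refl smooth_on_subset)

lemma smooth_fun_const: "smooth_fun B V (\<lambda>q. a)"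
  unfolding smooth_fun_def by (simp add: smooth_on_const)

context
  fixes B :: "('n::{t2_space, second_countable_topology}, 'f::euclidean_space) chart set"
  assumes B: "smooth_atlas B"
begin

lemma chart_of_atlas: "c \<in> B \<Longrightarrow> is_chart c"
  using B unfolding smooth_atlas_def by blast

lemma open_chart_image:
  assumes "c \<in> B" "open V"
  shows "open (snd c ` (fst c \<inter> V))"
  using chart_of_atlas[OF assms(1)] assms(2)
  by (intro is_chart_open_image) (auto simp: is_chart_def)

lemma smooth_fun_add:
  "open V \<Longrightarrow> smooth_fun B V h \<Longrightarrow> smooth_fun B V k \<Longrightarrow> smooth_fun B V (\<lambda>q. h q + k q)"
  unfolding smooth_fun_def using open_chart_image by (auto intro: smooth_on_add)

lemma smooth_fun_mult:
  "open V \<Longrightarrow> smooth_fun B V h \<Longrightarrow> smooth_fun B V k \<Longrightarrow> smooth_fun B V (\<lambda>q. h q * k q)"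
  unfolding smooth_fun_def using open_chart_image by (auto intro: smooth_on_mult)

lemma smooth_fun_sum:
  "open V \<Longrightarrow> (\<And>i. i \<in> I \<Longrightarrow> smooth_fun B V (h i)) \<Longrightarrow> smooth_fun B V (\<lambda>q. \<Sum>i\<in>I. h i q)"
  unfolding smooth_fun_def by (intro ballI smooth_on_sum open_chart_image) auto

lemma smooth_fun_diff:
  assumes "open V" "smooth_fun B V h" "smooth_fun B V k"
  shows "smooth_fun B V (\<lambda>q. h q - k q)"
  using smooth_fun_add[OF assms(1,2) smooth_fun_mult[OF assms(1) smooth_fun_const[of B V "-1"] assms(3)]]
  by simp

lemma smooth_fun_inverse:
  assumes "open V" "smooth_fun B V h" "\<And>q. q \<in> V \<Longrightarrow> h q \<noteq> 0"
  shows "smooth_fun B V (\<lambda>q. inverse (h q))"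
  unfolding smooth_fun_def
proof (intro ballI smooth_on_inverse)
  fix c x assume "c \<in> B" "x \<in> snd c ` (fst c \<inter> V)"
  then show "h (chart_inv c x) \<noteq> 0"
    using assms(3) chart_inv_chart[OF chart_of_atlas[OF \<open>c \<in> B\<close>]] by auto
qed (use assms open_chart_image in \<open>auto simp: smooth_fun_def\<close>)

lemma smooth_fun_divide:
  assumes "open V" "smooth_fun B V h" "smooth_fun B V k" "\<And>q. q \<in> V \<Longrightarrow> k q \<noteq> 0"
  shows "smooth_fun B V (\<lambda>q. h q / k q)"
  using smooth_fun_mult[OF assms(1,2) smooth_fun_inverse[OF assms(1,3,4)]] by (simp add: divide_inverse)

lemma smooth_fun_continuous:
  assumes V: "open V" "V \<subseteq> carrier B" and h: "smooth_fun B V h"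
  shows "continuous_on V h"
proof (intro continuous_at_imp_continuous_on ballI)
  fix q assume q: "q \<in> V"
  then obtain c where c: "c \<in> B" "q \<in> fst c"
    using V(2) unfolding carrier_def by blast
  note ch = chart_of_atlas[OF c(1)]
  have "continuous_on (fst c \<inter> V) (snd c)"
    using ch by (auto simp: is_chart_def homeomorphism_def intro: continuous_on_subset)
  moreover have "continuous_on (snd c ` (fst c \<inter> V)) (\<lambda>x. h (chart_inv c x))"
    using h c(1) smooth_on_continuous unfolding smooth_fun_def by blast
  ultimately have "continuous_on (fst c \<inter> V) (\<lambda>q. h (chart_inv c (snd c q)))"
    using continuous_on_compose2 by blast
  then have "continuous_on (fst c \<inter> V) h"
    by (rule continuous_on_eq) (use chart_inv_chart[OF ch] in auto)
  moreover have "open (fst c \<inter> V)"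
    using ch V(1) unfolding is_chart_def by blast
  ultimately show "isCont h q"
    using c(2) q continuous_on_eq_continuous_at by blast
qed

text \<open>Keeps the elimination pivot, and later the pairing of \<xi> with its partner field,
  invertible on a whole neighbourhood.\<close>

lemma smooth_fun_nonzero_open:
  assumes "open V" "V \<subseteq> carrier B" "smooth_fun B V h"
  shows "open {q \<in> V. h q \<noteq> 0}"
proof -
  have "{q \<in> V. h q \<noteq> 0} = V \<inter> h -` (- {0})" by auto
  then show ?thesis
    using continuous_open_preimage[OF smooth_fun_continuous[OF assms] assms(1), of "- {0}"] by (simp add: open_Compl)
qed

text \<open>Gaussian elimination: a column of an injective matrix has a nonzero pivot, and the pivot stays
  nonzero near \<open>p\<close>.\<close>

lemma smooth_linear_solve:
  assumes "finite I" "card I = r" "open V" "V \<subseteq> carrier B" "p \<in> V"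
    and "\<And>i j. i \<in> I \<Longrightarrow> j < r \<Longrightarrow> smooth_fun B V (G i j)"
    and "\<And>i. i \<in> I \<Longrightarrow> smooth_fun B V (b i)"
    and "\<And>y. (\<And>i. i \<in> I \<Longrightarrow> (\<Sum>j<r. G i j p * y j) = 0) \<Longrightarrow> \<forall>j<r. y j = 0"
  shows "\<exists>U x. open U \<and> p \<in> U \<and> U \<subseteq> V \<and> (\<forall>j<r. smooth_fun B U (x j)) \<and>
    (\<forall>q\<in>U. \<forall>i\<in>I. (\<Sum>j<r. G i j q * x j q) = b i q)"
  using assms
proof (induction r arbitrary: I V G b)
  case 0
  then show ?case by auto
next
  case (Suc r)
  note smG = Suc.prems(6) and smb = Suc.prems(7) and inj = Suc.prems(8)
  obtain k where k: "k \<in> I" "G k r p \<noteq> 0"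
  proof (rule ccontr)
    assume "\<not> thesis"
    then have "\<forall>i\<in>I. G i r p = 0" using that by blast
    \<comment> \<open>A vanishing column would put the last unit vector into the kernel.\<close>
    then have "\<forall>j<Suc r. (if j = r then 1 else 0 :: real) = 0"
      by (intro inj) auto
    then show False by auto
  qed
  define V1 where "V1 = {q \<in> V. G k r q \<noteq> 0}"
  have V1: "open V1" "V1 \<subseteq> V" "V1 \<subseteq> carrier B" "p \<in> V1"
    using smooth_fun_nonzero_open[OF Suc.prems(3,4) smG[OF k(1)]] Suc.prems(4,5) k(2)
    by (auto simp: V1_def)
  have pivot: "G k r q \<noteq> 0" if "q \<in> V1" for q
    using that by (simp add: V1_def)
  have smG1: "smooth_fun B V1 (G i j)" if "i \<in> I" "j < Suc r" for i j
    using smG that V1(2) smooth_fun_subset by blast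
  have smb1: "smooth_fun B V1 (b i)" if "i \<in> I" for i
    using smb that V1(2) smooth_fun_subset by blast
  define m where "m i q = G i r q / G k r q" for i q
  have smm: "smooth_fun B V1 (m i)" if "i \<in> I" for i
    unfolding m_def using V1(1) smG1 k(1) that pivot by (intro smooth_fun_divide) auto
  \<comment> \<open>Row i minus \<open>m i\<close> times row k clears column r; row k then leaves
    the system, so r rows remain for the r remaining unknowns.\<close>
  define G' where "G' i j q = G i j q - m i q * G k j q" for i j q
  define b' where "b' i q = b i q - m i q * b k q" for i q
  have "\<exists>U x. open U \<and> p \<in> U \<and> U \<subseteq> V1 \<and> (\<forall>j<r. smooth_fun B U (x j)) \<and>
    (\<forall>q\<in>U. \<forall>i\<in>I - {k}. (\<Sum>j<r. G' i j q * x j q) = b' i q)"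
  proof (rule Suc.IH)
    show "smooth_fun B V1 (G' i j)" if "i \<in> I - {k}" "j < r" for i j
      unfolding G'_def using that k(1) by (intro smooth_fun_diff smooth_fun_mult smG1 smm V1(1)) auto
    show "smooth_fun B V1 (b' i)" if "i \<in> I - {k}" for i
      unfolding b'_def using that k(1) by (intro smooth_fun_diff smooth_fun_mult smb1 smm V1(1)) auto
    fix y :: "nat \<Rightarrow> real"
    assume y: "(\<Sum>j<r. G' i j p * y j) = 0" if "i \<in> I - {k}" for i
    \<comment> \<open>Back substitution in row k extends a kernel vector of the reduced matrix to
      one of the full matrix, so injectivity at p is inherited.\<close>
    define z where "z j = (if j = r then - (\<Sum>j<r. G k j p * y j) / G k r p else y j)" for j
    have "(\<Sum>j<Suc r. G i j p * z j) = 0" if i: "i \<in> I" for i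
    proof -
      have "(\<Sum>j<r. G i j p * y j) = m i p * (\<Sum>j<r. G k j p * y j)"
      proof (cases "i = k")
        case False
        then show ?thesis
          using y[of i] i by (simp add: G'_def left_diff_distrib sum_subtractf sum_distrib_left mult.assoc)
      qed (use k in \<open>simp add: m_def\<close>)
      then show ?thesis
        using k(2) by (simp add: z_def m_def)
    qed
    then have "\<forall>j<Suc r. z j = 0" by (rule inj)
    then show "\<forall>j<r. y j = 0" by (metis z_def less_Suc_eq nat_neq_iff)
  qed (use Suc.prems V1 k in auto)
  then obtain U x where U: "open U" "p \<in> U" "U \<subseteq> V1" and smx: "\<And>j. j < r \<Longrightarrow> smooth_fun B U (x j)"
    and sol: "\<And>q i. q \<in> U \<Longrightarrow> i \<in> I - {k} \<Longrightarrow> (\<Sum>j<r. G' i j q * x j q) = b' i q"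
    by blast
  \<comment> \<open>Row k, read as an equation, yields the last unknown; every other row is its
    reduced equation plus \<open>m i\<close> times row k.\<close>
  define w where "w j q = (if j = r then (b k q - (\<Sum>j<r. G k j q * x j q)) / G k r q else x j q)" for j q
  have "smooth_fun B U (\<lambda>q. (b k q - (\<Sum>j<r. G k j q * x j q)) / G k r q)"
    using k(1) U pivot
    by (intro smooth_fun_divide smooth_fun_diff smooth_fun_sum smooth_fun_mult smx
         smooth_fun_subset[OF smG1 U(3)] smooth_fun_subset[OF smb1 U(3)]) auto
  then have smw: "smooth_fun B U (w j)" if "j < Suc r" for j
    using smx that by (cases "j = r") (auto simp: w_def[abs_def])
  have "(\<Sum>j<Suc r. G i j q * w j q) = b i q" if q: "q \<in> U" and i: "i \<in> I" for q i
  proof -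
    have nz: "G k r q \<noteq> 0" using q U(3) pivot by blast
    have "(\<Sum>j<r. G i j q * x j q) = b i q - m i q * b k q + m i q * (\<Sum>j<r. G k j q * x j q)"
    proof (cases "i = k")
      case False
      then show ?thesis
        using sol[of q i] q i
        by (simp add: G'_def b'_def left_diff_distrib sum_subtractf sum_distrib_left mult.assoc)
    qed (use nz in \<open>simp add: m_def\<close>)
    moreover have "G i r q * w r q = m i q * (b k q - (\<Sum>j<r. G k j q * x j q))"
      by (simp add: w_def m_def)
    moreover have "(\<Sum>j<r. G i j q * w j q) = (\<Sum>j<r. G i j q * x j q)"
      by (simp add: w_def)
    ultimately show ?thesis
      by (simp add: right_diff_distrib)
  qed
  then show ?case
    using U V1(2) smw by (intro exI[of _ U] exI[of _ w] conjI) auto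
qed

end

section \<open>Vector fields along a map\<close>

locale manifold_map =
  fixes A :: "('m::{t2_space, second_countable_topology}, 'e::euclidean_space) chart set"
    and B :: "('n::{t2_space, second_countable_topology}, 'f::euclidean_space) chart set"
    and f :: "'n \<Rightarrow> 'm"
  assumes A: "smooth_atlas A" and B: "smooth_atlas B" and f: "smooth_map B A f"
begin

lemma map_into: "p \<in> carrier B \<Longrightarrow> f p \<in> carrier A"
  using f unfolding smooth_map_def by blast

lemma open_preimage:
  assumes "open V" "V \<subseteq> carrier B" "c' \<in> A"
  shows "open (V \<inter> f -` fst c')"
proof -
  have "continuous_on V f"
    using f assms(2) continuous_on_subset unfolding smooth_map_def by blast
  moreover have "open (fst c')"
    using A assms(3) unfolding smooth_atlas_def is_chart_def by blast
  ultimately show ?thesis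
    using continuous_open_preimage assms(1) by blast
qed

lemma open_section_domain:
  assumes "open V" "V \<subseteq> carrier B" "c \<in> B" "c' \<in> A"
  shows "open (snd c ` (fst c \<inter> V \<inter> f -` fst c'))"
  using open_chart_image[OF B assms(3) open_preimage[OF assms(1,2,4)]] by (simp add: Int_assoc)

text \<open>Here \<open>k\<close> is the coordinate expression of an ambient object, such as a
  metric coefficient or a component of a vector field; composition with the coordinate form of f
  transports its smoothness to the charts of \<open>B\<close>.\<close>

lemma smooth_on_pullback:
  assumes V: "open V" "V \<subseteq> carrier B" and c: "c \<in> B" "c' \<in> A"
    and k: "smooth_on T k" "\<And>q. q \<in> fst c \<inter> V \<inter> f -` fst c' \<Longrightarrow> snd c' (f q) \<in> T"
  shows "smooth_on (snd c ` (fst c \<inter> V \<inter> f -` fst c')) (\<lambda>x. k (snd c' (f (chart_inv c x))))"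
proof (rule smooth_on_compose[OF open_section_domain[OF V c] _ k(1)])
  have "smooth_on (snd c ` (fst c \<inter> f -` fst c')) (\<lambda>x. snd c' (f (chart_inv c x)))"
    using f c unfolding smooth_map_def comp_def by blast
  then show "smooth_on (snd c ` (fst c \<inter> V \<inter> f -` fst c')) (\<lambda>x. snd c' (f (chart_inv c x)))"
    by (rule smooth_on_subset) auto
  show "(\<lambda>x. snd c' (f (chart_inv c x))) ` snd c ` (fst c \<inter> V \<inter> f -` fst c') \<subseteq> T"
    using k(2) chart_inv_chart[OF chart_of_atlas[OF B c(1)]] by auto
qed

lemma smooth_section_tangent: "smooth_section B A f V X \<Longrightarrow> q \<in> V \<Longrightarrow> X q \<in> tangent_space A (f q)"
  unfolding smooth_section_def by blast

lemma smooth_section_components: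
  "smooth_section B A f V X \<Longrightarrow> c \<in> B \<Longrightarrow> c' \<in> A \<Longrightarrow>
    smooth_on (snd c ` (fst c \<inter> V \<inter> f -` fst c')) (\<lambda>x. X (chart_inv c x) c')"
  unfolding smooth_section_def by blast

lemma smooth_section_subset:
  assumes "smooth_section B A f V X" "U \<subseteq> V"
  shows "smooth_section B A f U X"
  unfolding smooth_section_def
proof (intro conjI ballI)
  fix c c' assume "c \<in> B" "c' \<in> A"
  from smooth_section_components[OF assms(1) this]
  show "smooth_on (snd c ` (fst c \<inter> U \<inter> f -` fst c')) (\<lambda>x. X (chart_inv c x) c')"
    by (rule smooth_on_subset) (use assms(2) in auto)
qed (use assms smooth_section_tangent in blast)

lemma smooth_section_cong:
  assumes V: "open V" "V \<subseteq> carrier B" and "\<And>q. q \<in> V \<Longrightarrow> X q = Y q" "smooth_section B A f V X"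
  shows "smooth_section B A f V Y"
  unfolding smooth_section_def
proof (intro conjI ballI)
  fix c c' assume c: "c \<in> B" "c' \<in> A"
  show "smooth_on (snd c ` (fst c \<inter> V \<inter> f -` fst c')) (\<lambda>x. Y (chart_inv c x) c')"
    by (rule smooth_on_cong[OF open_section_domain[OF V c] _ smooth_section_components[OF assms(4) c]])
       (use assms(3) chart_inv_chart[OF chart_of_atlas[OF B c(1)]] in auto)
qed (use assms smooth_section_tangent in metis)

text \<open>Projections are constructed only near each point, so global smoothness of W' is
  assembled from neighbourhoods.\<close>

lemma smooth_section_local:
  assumes V: "V \<subseteq> carrier B"
    and loc: "\<And>p. p \<in> V \<Longrightarrow> \<exists>U. open U \<and> p \<in> U \<and> U \<subseteq> V \<and> smooth_section B A f U X"
  shows "smooth_section B A f V X"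
  unfolding smooth_section_def
proof (intro conjI ballI smooth_on_local)
  fix p assume "p \<in> V"
  then show "X p \<in> tangent_space A (f p)"
    using loc smooth_section_tangent by blast
next
  fix c c' x assume c: "c \<in> B" "c' \<in> A" and "x \<in> snd c ` (fst c \<inter> V \<inter> f -` fst c')"
  then obtain p where p: "p \<in> fst c \<inter> V \<inter> f -` fst c'" "x = snd c p" by blast
  then obtain U where U: "open U" "p \<in> U" "U \<subseteq> V" "smooth_section B A f U X"
    using loc by blast
  then show "\<exists>O'. open O' \<and> x \<in> O' \<and> smooth_on O' (\<lambda>x. X (chart_inv c x) c')"
    using open_section_domain[OF U(1) _ c] V smooth_section_components[OF U(4) c] p
    by (intro exI[of _ "snd c ` (fst c \<inter> U \<inter> f -` fst c')"]) auto
qed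

lemma smooth_section_add:
  assumes V: "open V" "V \<subseteq> carrier B" and X: "smooth_section B A f V X" "smooth_section B A f V Y"
  shows "smooth_section B A f V (\<lambda>q. X q + Y q)"
  unfolding smooth_section_def
proof (intro conjI ballI)
  fix c c' assume c: "c \<in> B" "c' \<in> A"
  show "smooth_on (snd c ` (fst c \<inter> V \<inter> f -` fst c')) (\<lambda>x. (X (chart_inv c x) + Y (chart_inv c x)) c')"
    using smooth_on_add[OF open_section_domain[OF V c] smooth_section_components[OF X(1) c]
        smooth_section_components[OF X(2) c]] by simp
qed (use X smooth_section_tangent subspace_tangent_space[OF A] in \<open>blast intro: subspace_add\<close>)

lemma smooth_section_scaleR:
  assumes V: "open V" "V \<subseteq> carrier B" and h: "smooth_fun B V h" and X: "smooth_section B A f V X"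
  shows "smooth_section B A f V (\<lambda>q. h q *\<^sub>R X q)"
  unfolding smooth_section_def
proof (intro conjI ballI)
  fix c c' assume c: "c \<in> B" "c' \<in> A"
  have "smooth_on (snd c ` (fst c \<inter> V \<inter> f -` fst c')) (\<lambda>x. h (chart_inv c x))"
    using h c(1) unfolding smooth_fun_def by (auto intro: smooth_on_subset)
  then show "smooth_on (snd c ` (fst c \<inter> V \<inter> f -` fst c')) (\<lambda>x. (h (chart_inv c x) *\<^sub>R X (chart_inv c x)) c')"
    using smooth_on_scaleR[OF open_section_domain[OF V c] _ smooth_section_components[OF X c]]
    by (simp add: scaleR_fun_def)
qed (use X smooth_section_tangent subspace_tangent_space[OF A] in \<open>blast intro: subspace_scale\<close>)

lemma smooth_section_0: "smooth_section B A f V (\<lambda>q. 0)"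
  unfolding smooth_section_def
  using subspace_tangent_space[OF A] by (auto simp: smooth_on_const subspace_0)

lemma smooth_section_sum:
  assumes V: "open V" "V \<subseteq> carrier B" and "\<And>i. i \<in> I \<Longrightarrow> smooth_section B A f V (X i)"
  shows "smooth_section B A f V (\<lambda>q. \<Sum>i\<in>I. X i q)"
  using assms(3)
  by (induction I rule: infinite_finite_induct) (auto intro: smooth_section_add[OF V] smooth_section_0)

lemma smooth_section_diff:
  assumes V: "open V" "V \<subseteq> carrier B" and X: "smooth_section B A f V X" "smooth_section B A f V Y"
  shows "smooth_section B A f V (\<lambda>q. X q - Y q)"
  using smooth_section_add[OF V X(1) smooth_section_scaleR[OF V smooth_fun_const[of B V "-1"] X(2)]]
  by simp

text \<open>In another chart d the components are the derivative, in the fixed direction u, of the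
  transition from c' to d, evaluated along f. The result serves to extend a single tangent vector to
  a smooth local field.\<close>

lemma smooth_section_coord_vec:
  assumes V: "open V" "V \<subseteq> carrier B" "V \<subseteq> f -` fst c'" and c': "c' \<in> A"
  shows "smooth_section B A f V (\<lambda>q. coord_vec A c' (f q) u)"
  unfolding smooth_section_def
proof (intro conjI ballI)
  fix q assume "q \<in> V"
  then show "coord_vec A c' (f q) u \<in> tangent_space A (f q)"
    using V(3) coord_vec_in_tangent_space[OF A c'] by blast
next
  fix c d assume c: "c \<in> B" "d \<in> A"
  let ?O = "snd c ` (fst c \<inter> V \<inter> f -` fst d)"
  let ?D = "\<lambda>y. frechet_derivative (snd d \<circ> chart_inv c') (at y) u"
  have "smooth_on (snd c' ` (fst c' \<inter> fst d)) ?D"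
    using smooth_on_frechet_derivative[OF smooth_atlas_transition[OF A c' c(2)]] by (simp add: comp_def)
  then have "smooth_on (snd c ` (fst c \<inter> (V \<inter> f -` fst d) \<inter> f -` fst c'))
      (\<lambda>x. ?D (snd c' (f (chart_inv c x))))"
    by (rule smooth_on_pullback[OF open_preimage[OF V(1,2) c(2)] le_infI1[OF V(2)] c(1) c']) auto
  then have *: "smooth_on ?O (\<lambda>x. ?D (snd c' (f (chart_inv c x))))"
    by (rule smooth_on_subset) (use V(3) in auto)
  show "smooth_on ?O (\<lambda>x. coord_vec A c' (f (chart_inv c x)) u d)"
    by (rule smooth_on_cong[OF open_section_domain[OF V(1,2) c] _ *])
       (use c(2) chart_inv_chart[OF chart_of_atlas[OF B c(1)]] in \<open>auto simp: coord_vec_def\<close>)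
qed

lemma smooth_section_pullback:
  assumes "vector_field A Z" "open V" "V \<subseteq> carrier B"
  shows "smooth_section B A f V (\<lambda>q. Z (f q))"
  unfolding smooth_section_def
proof (intro conjI ballI)
  fix q assume "q \<in> V"
  then show "Z (f q) \<in> tangent_space A (f q)"
    using assms map_into unfolding vector_field_def smooth_section_def by blast
next
  fix c c' assume c: "c \<in> B" "c' \<in> A"
  have ch: "is_chart c'" using A c(2) unfolding smooth_atlas_def by blast
  have sub: "fst c' \<subseteq> carrier A" using c(2) unfolding carrier_def by blast
  have "smooth_on (snd c' ` (fst c' \<inter> carrier A \<inter> (\<lambda>p. p) -` fst c')) (\<lambda>y. Z (chart_inv c' y) c')"
    using assms(1) c(2) unfolding vector_field_def smooth_section_def by blast
  then have "smooth_on (snd c ` (fst c \<inter> V \<inter> f -` fst c'))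
     (\<lambda>x. Z (chart_inv c' (snd c' (f (chart_inv c x)))) c')"
    by (rule smooth_on_pullback[OF assms(2,3) c]) (use sub in auto)
  then show "smooth_on (snd c ` (fst c \<inter> V \<inter> f -` fst c')) (\<lambda>x. Z (f (chart_inv c x)) c')"
    by (rule smooth_on_cong[OF open_section_domain[OF assms(2,3) c], rotated])
       (use chart_inv_chart[OF chart_of_atlas[OF B c(1)]] chart_inv_chart[OF ch] in auto)
qed

end

section \<open>The ambient metric along a map\<close>

locale metric_map = manifold_map A B f
  for A :: "('m::{t2_space, second_countable_topology}, 'e::euclidean_space) chart set"
    and B :: "('n::{t2_space, second_countable_topology}, 'f::euclidean_space) chart set"
    and f :: "'n \<Rightarrow> 'm" +
  fixes g :: "'m \<Rightarrow> ('m, 'e) tvec \<Rightarrow> ('m, 'e) tvec \<Rightarrow> real"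
  assumes metric: "indefinite_metric A g"
begin

lemma metric_linear:
  "p \<in> carrier A \<Longrightarrow> x \<in> tangent_space A p \<Longrightarrow> linear_within (tangent_space A p) (g p x)"
  using metric unfolding indefinite_metric_def by blast

lemma metric_sym:
  "p \<in> carrier A \<Longrightarrow> x \<in> tangent_space A p \<Longrightarrow> y \<in> tangent_space A p \<Longrightarrow> g p x y = g p y x"
  using metric unfolding indefinite_metric_def by blast

text \<open>Smoothness of the metric is given on coordinate vectors, so g(x, y) is written through
  those values and the components of x and y.\<close>

lemma metric_coord_vec:
  assumes "p \<in> fst c" "c \<in> A" "x \<in> tangent_space A p" "y \<in> tangent_space A p"
  shows "g p x y = (\<Sum>b\<in>Basis. (y c \<bullet> b) * (\<Sum>b'\<in>Basis. (x c \<bullet> b') * g p (coord_vec A c p b) (coord_vec A c p b')))"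
proof -
  have p: "p \<in> carrier A" using assms unfolding carrier_def by blast
  note T = subspace_tangent_space[OF A]
  note cv = coord_vec_in_tangent_space[OF A assms(2,1)]
  have expand: "z = (\<Sum>b\<in>Basis. (z c \<bullet> b) *\<^sub>R coord_vec A c p b)" if "z \<in> tangent_space A p" for z
    using tangent_space_eq_coord_vec[OF that assms(2,1)] coord_vec_sum_Basis[OF A assms(2,1)] by metis
  have lin: "F z = (\<Sum>b\<in>Basis. (z c \<bullet> b) * F (coord_vec A c p b))"
    if F: "linear_within (tangent_space A p) F" and z: "z \<in> tangent_space A p" for F :: "('m, 'e) tvec \<Rightarrow> real" and z
    using linear_within_sum[OF T F, of Basis "coord_vec A c p" "\<lambda>b. z c \<bullet> b"] cv
    by (simp add: expand[OF z, symmetric])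
  have "g p x (coord_vec A c p b) = (\<Sum>b'\<in>Basis. (x c \<bullet> b') * g p (coord_vec A c p b) (coord_vec A c p b'))" for b
    using lin[OF metric_linear[OF p cv] assms(3)] metric_sym[OF p assms(3) cv] by simp
  then show ?thesis
    using lin[OF metric_linear[OF p assms(3)] assms(4)] by simp
qed

text \<open>A target chart c' can be fixed only near a point, so the claim is proved locally; there
  g(X, Y) is a finite sum of products of components of X and Y with metric coefficients pulled back
  along f.\<close>

lemma smooth_fun_metric:
  assumes V: "open V" "V \<subseteq> carrier B" and X: "smooth_section B A f V X" and Y: "smooth_section B A f V Y"
  shows "smooth_fun B V (\<lambda>q. g (f q) (X q) (Y q))"
  unfolding smooth_fun_def
proof (intro ballI smooth_on_local)
  fix c x assume c: "c \<in> B" and "x \<in> snd c ` (fst c \<inter> V)"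
  then obtain p where p: "p \<in> fst c" "p \<in> V" "x = snd c p" by blast
  obtain c' where c': "c' \<in> A" "f p \<in> fst c'"
    using map_into p(2) V(2) unfolding carrier_def by blast
  let ?O = "snd c ` (fst c \<inter> V \<inter> f -` fst c')"
  let ?G = "\<lambda>q b b'. g q (coord_vec A c' q b) (coord_vec A c' q b')"
  note O = open_section_domain[OF V c c'(1)]
  have ch: "is_chart c'" using A c' unfolding smooth_atlas_def by blast
  have smG: "smooth_on ?O (\<lambda>x. ?G (chart_inv c' (snd c' (f (chart_inv c x)))) b b')" for b b'
    by (rule smooth_on_pullback[OF V c c'(1), of "snd c' ` fst c'" "\<lambda>y. ?G (chart_inv c' y) b b'"])
       (use metric c' in \<open>auto simp: indefinite_metric_def\<close>)
  have "smooth_on ?O (\<lambda>x. \<Sum>b\<in>Basis. (Y (chart_inv c x) c' \<bullet> b) *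
      (\<Sum>b'\<in>Basis. (X (chart_inv c x) c' \<bullet> b') * ?G (chart_inv c' (snd c' (f (chart_inv c x)))) b b'))"
    by (intro smooth_on_sum smooth_on_mult smooth_on_inner smooth_on_const smG O
        smooth_section_components[OF X c c'(1)] smooth_section_components[OF Y c c'(1)])
  then have "smooth_on ?O (\<lambda>x. g (f (chart_inv c x)) (X (chart_inv c x)) (Y (chart_inv c x)))"
  proof (rule smooth_on_cong[OF O, rotated])
    fix y assume "y \<in> ?O"
    then obtain q where q: "q \<in> fst c" "q \<in> V" "f q \<in> fst c'" "y = snd c q" by blast
    then show "(\<Sum>b\<in>Basis. (Y (chart_inv c y) c' \<bullet> b) *
      (\<Sum>b'\<in>Basis. (X (chart_inv c y) c' \<bullet> b') * ?G (chart_inv c' (snd c' (f (chart_inv c y)))) b b')) =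
      g (f (chart_inv c y)) (X (chart_inv c y)) (Y (chart_inv c y))"
      using metric_coord_vec[OF q(3) c'(1) smooth_section_tangent[OF X q(2)] smooth_section_tangent[OF Y q(2)]]
        chart_inv_chart[OF chart_of_atlas[OF B c] q(1)] chart_inv_chart[OF ch q(3)]
      by simp
  qed
  moreover have "x \<in> ?O" using p c' by auto
  ultimately show "\<exists>U. open U \<and> x \<in> U \<and>
      smooth_on U (\<lambda>x. g (f (chart_inv c x)) (X (chart_inv c x)) (Y (chart_inv c x)))"
    using O by blast
qed

end

section \<open>Projection onto nondegenerate subbundles\<close>

text \<open>A nontrivial relation makes some X k a combination of the others, so at most r - 1
  vectors would span a space of dimension r. Counting indices rather than vectors also rules out
  repetitions.\<close>

lemma frame_independent:
  fixes X :: "nat \<Rightarrow> 'v::real_vector"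
  assumes "dim (span (X ` {..<r})) = r" "(\<Sum>j<r. y j *\<^sub>R X j) = 0"
  shows "\<forall>j<r. y j = 0"
proof (rule ccontr)
  assume "\<not> ?thesis"
  then obtain k where k: "k < r" "y k \<noteq> 0" by blast
  let ?J = "{..<r} - {k}"
  have "(\<Sum>j<r. y j *\<^sub>R X j) = y k *\<^sub>R X k + (\<Sum>j\<in>?J. y j *\<^sub>R X j)"
    using k(1) by (simp add: sum.remove)
  then have "y k *\<^sub>R X k = - (\<Sum>j\<in>?J. y j *\<^sub>R X j)"
    using assms(2) by (simp add: eq_neg_iff_add_eq_0)
  then have "inverse (y k) *\<^sub>R y k *\<^sub>R X k = inverse (y k) *\<^sub>R - (\<Sum>j\<in>?J. y j *\<^sub>R X j)"
    by simp
  then have "X k = inverse (y k) *\<^sub>R - (\<Sum>j\<in>?J. y j *\<^sub>R X j)"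
    using k(2) by simp
  also have "\<dots> \<in> span (X ` ?J)"
    by (intro span_scale span_neg span_sum) (auto intro: span_base)
  finally have "X k \<in> span (X ` ?J)" .
  then have "X j \<in> span (X ` ?J)" if "j < r" for j
    using that by (cases "j = k") (auto intro: span_base)
  then have "X ` {..<r} \<subseteq> span (X ` ?J)" by blast
  then have "span (X ` {..<r}) \<subseteq> span (X ` ?J)"
    by (rule span_minimal) simp
  then have "dim (span (X ` {..<r})) \<le> card (X ` ?J)"
    by (rule dim_le_card) simp
  also have "\<dots> \<le> card ?J" by (rule card_image_le) simp
  also have "\<dots> < r" using k(1) by simp
  finally show False using assms(1) by simp
qed

lemma subbundle_frame:
  assumes E: "subbundle B A f r E" and p: "p \<in> carrier B"
  obtains V X where "open V" "p \<in> V" "V \<subseteq> carrier B"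
    "\<And>j. j < r \<Longrightarrow> smooth_section B A f V (X j)"
    "\<And>q. q \<in> V \<Longrightarrow> E q = span ((\<lambda>j::nat. X j q) ` {..<r})"
proof -
  obtain V X where "open V \<and> p \<in> V \<and> V \<subseteq> carrier B \<and> (\<forall>j<r. smooth_section B A f V (X j)) \<and>
      (\<forall>q\<in>V. E q = span ((\<lambda>j::nat. X j q) ` {..<r}))"
    using bspec[OF conjunct2[OF E[unfolded subbundle_def]] p] by (elim exE)
  then show thesis by (intro that[of V X]) simp_all
qed

lemma subbundle_fibre:
  assumes "subbundle B A f r E" "p \<in> carrier B"
  shows "subspace (E p)" "E p \<subseteq> tangent_space A (f p)" "dim (E p) = r"
  using bspec[OF conjunct1[OF assms(1)[unfolded subbundle_def]] assms(2)] by simp_all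

context metric_map
begin

lemma metric_linear_left:
  assumes "p \<in> carrier A" "y \<in> tangent_space A p"
  shows "linear_within (tangent_space A p) (\<lambda>x. g p x y)"
  using metric_linear[OF assms] metric_sym[OF assms(1) _ assms(2)] subspace_tangent_space[OF A, of p]
  unfolding linear_within_def by (simp add: subspace_add subspace_scale)

lemma subspace_orth:
  assumes "p \<in> carrier A" "E \<subseteq> tangent_space A p"
  shows "subspace (orth (g p) (tangent_space A p) E)"
proof -
  note T = subspace_tangent_space[OF A, of p]
  have lin: "linear_within (tangent_space A p) (\<lambda>x. g p x y)" if "y \<in> E" for y
    using that assms metric_linear_left by blast
  show ?thesis
  proof (rule subspaceI)
    show "0 \<in> orth (g p) (tangent_space A p) E"
      using linear_within_0[OF T lin] subspace_0[OF T] by (simp add: orth_def)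
  next
    fix x z assume "x \<in> orth (g p) (tangent_space A p) E" "z \<in> orth (g p) (tangent_space A p) E"
    then show "x + z \<in> orth (g p) (tangent_space A p) E"
      using lin subspace_add[OF T] by (simp add: orth_def linear_within_def)
  next
    fix c x assume "x \<in> orth (g p) (tangent_space A p) E"
    then show "c *\<^sub>R x \<in> orth (g p) (tangent_space A p) E"
      using lin subspace_scale[OF T] by (simp add: orth_def linear_within_def)
  qed
qed

lemma orth_span:
  assumes p: "p \<in> carrier A" and x: "x \<in> tangent_space A p" and E: "E \<subseteq> tangent_space A p"
    and "\<And>y. y \<in> E \<Longrightarrow> g p x y = 0" and y: "y \<in> span E"
  shows "g p x y = 0"
proof -
  have "E \<subseteq> orth (g p) (tangent_space A p) {x}"
    using assms(4) E metric_sym[OF p _ x] by (auto simp: orth_def subset_iff)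
  then have "y \<in> orth (g p) (tangent_space A p) {x}"
    using span_minimal[OF _ subspace_orth[OF p]] x y by blast
  then show ?thesis
    using metric_sym[OF p x] unfolding orth_def by auto
qed

text \<open>The matrix is the Gram matrix of the frame E, the right-hand side the pairings of E with
  X. A kernel vector y at p gives a vector of \<open>S p\<close> orthogonal to all of
  \<open>S p\<close>, hence zero by nondegeneracy, and y = 0 by independence of the frame.
  Injectivity is tested at p alone; \<open>smooth_linear_solve\<close> then solves the system on a
  smaller neighbourhood U.\<close>

lemma smooth_projection:
  assumes S: "subbundle B A f r S" and nondeg: "\<And>p. p \<in> carrier B \<Longrightarrow> nondegenerate_on (g (f p)) (S p)"
    and V: "open V" "V \<subseteq> carrier B" "p \<in> V" and X: "smooth_section B A f V X"
  shows "\<exists>U Y. open U \<and> p \<in> U \<and> U \<subseteq> V \<and> smooth_section B A f U Y \<and>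
    (\<forall>q\<in>U. Y q \<in> S q \<and> (\<forall>z\<in>S q. g (f q) (X q - Y q) z = 0))"
proof -
  have pB: "p \<in> carrier B" using V by blast
  obtain V0 E where V0: "open V0" "p \<in> V0" and E: "\<And>j. j < r \<Longrightarrow> smooth_section B A f V0 (E j)"
    and span: "\<And>q. q \<in> V0 \<Longrightarrow> S q = span ((\<lambda>j::nat. E j q) ` {..<r})"
    using subbundle_frame[OF S pB] by metis
  define V1 where "V1 = V \<inter> V0"
  have V1: "open V1" "V1 \<subseteq> carrier B" "p \<in> V1" "V1 \<subseteq> V" "V1 \<subseteq> V0"
    using V V0 by (auto simp: V1_def)
  have E1: "smooth_section B A f V1 (E j)" if "j < r" for j
    using E that V1(5) smooth_section_subset by blast
  have X1: "smooth_section B A f V1 X"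
    using X V1(4) smooth_section_subset by blast
  note ET = smooth_section_tangent[OF E1]
  have E_in_S: "E j q \<in> S q" if "q \<in> V1" "j < r" for j q
    using span[of q] that V1(5) by (auto intro: span_base)
  define G where "G i j q = g (f q) (E i q) (E j q)" for i j q
  define b where "b i q = g (f q) (E i q) (X q)" for i q
  have expand: "g (f q) (E i q) (\<Sum>j<r. y j *\<^sub>R E j q) = (\<Sum>j<r. G i j q * y j)"
    if "q \<in> V1" "i < r" for y i q
    using linear_within_sum[OF subspace_tangent_space[OF A] metric_linear[OF map_into ET[of i q]],
        of "{..<r}" "\<lambda>j. E j q" y] that ET V1(2)
    by (auto simp: G_def mult.commute)
  have S_le: "S q \<subseteq> tangent_space A (f q)" if "q \<in> V1" for q
    using subbundle_fibre(2)[OF S] that V1(2) by blast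
  have orthI: "\<forall>z\<in>S q. g (f q) w z = 0"
    if "q \<in> V1" "w \<in> tangent_space A (f q)" "\<And>i. i < r \<Longrightarrow> g (f q) w (E i q) = 0" for q w
    using orth_span[OF map_into that(2), of "(\<lambda>j. E j q) ` {..<r}"] that V1(2,5) ET span[of q] by fastforce
  have "\<exists>U x. open U \<and> p \<in> U \<and> U \<subseteq> V1 \<and> (\<forall>j<r. smooth_fun B U (x j)) \<and>
      (\<forall>q\<in>U. \<forall>i\<in>{..<r}. (\<Sum>j<r. G i j q * x j q) = b i q)"
  proof (rule smooth_linear_solve[OF B])
    show "smooth_fun B V1 (G i j)" if "i \<in> {..<r}" "j < r" for i j
      using that smooth_fun_metric[OF V1(1,2) E1 E1] by (simp add: G_def[abs_def])
    show "smooth_fun B V1 (b i)" if "i \<in> {..<r}" for i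
      using that smooth_fun_metric[OF V1(1,2) E1 X1] by (simp add: b_def[abs_def])
    fix y :: "nat \<Rightarrow> real"
    assume y: "\<And>i. i \<in> {..<r} \<Longrightarrow> (\<Sum>j<r. G i j p * y j) = 0"
    let ?s = "\<Sum>j<r. y j *\<^sub>R E j p"
    have s: "?s \<in> S p"
      using span[OF V0(2)] by (auto intro!: span_sum span_scale intro: span_base)
    then have sT: "?s \<in> tangent_space A (f p)" using S_le V1(3) by blast
    have "g (f p) ?s (E i p) = 0" if "i < r" for i
      using expand[OF V1(3) that] y that metric_sym[OF map_into[OF pB] sT ET[OF that V1(3)]] by simp
    then have "\<forall>z\<in>S p. g (f p) ?s z = 0" by (rule orthI[OF V1(3) sT])
    then have "?s = 0"
      using nondeg[OF pB] s unfolding nondegenerate_on_def by blast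
    moreover have "dim (span ((\<lambda>j. E j p) ` {..<r})) = r"
      using subbundle_fibre(3)[OF S pB] span[OF V0(2)] by simp
    ultimately show "\<forall>j<r. y j = 0" by (intro frame_independent)
  qed (use V1 in auto)
  then obtain U x where U: "open U" "p \<in> U" "U \<subseteq> V1" and x: "\<And>j. j < r \<Longrightarrow> smooth_fun B U (x j)"
    and sol: "\<And>q i. q \<in> U \<Longrightarrow> i < r \<Longrightarrow> (\<Sum>j<r. G i j q * x j q) = b i q"
    unfolding Ball_def lessThan_iff by blast
  let ?Y = "\<lambda>q. \<Sum>j<r. x j q *\<^sub>R E j q"
  have "U \<subseteq> carrier B" using U V1 by blast
  then have "smooth_section B A f U ?Y"
    using U(1) x E1 smooth_section_subset[OF _ U(3)] by (intro smooth_section_sum smooth_section_scaleR) auto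
  moreover have "?Y q \<in> S q \<and> (\<forall>z\<in>S q. g (f q) (X q - ?Y q) z = 0)" if q: "q \<in> U" for q
  proof
    have q1: "q \<in> V1" using q U by blast
    then have qA: "f q \<in> carrier A" using V1(2) map_into by blast
    show Y: "?Y q \<in> S q"
      using span[of q] q1 V1(5) by (auto intro!: span_sum span_scale intro: span_base)
    have YT: "?Y q \<in> tangent_space A (f q)" using Y S_le q1 by blast
    have XT: "X q \<in> tangent_space A (f q)" using smooth_section_tangent[OF X1 q1] .
    have dT: "X q - ?Y q \<in> tangent_space A (f q)"
      using XT YT subspace_tangent_space[OF A] subspace_diff by blast
    show "\<forall>z\<in>S q. g (f q) (X q - ?Y q) z = 0"
    proof (rule orthI[OF q1 dT])
      fix i assume i: "i < r"
      \<comment> \<open>Row i of the system says exactly that the residual is orthogonal to E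
        i.\<close>
      have "g (f q) (E i q) (X q - ?Y q) = b i q - (\<Sum>j<r. G i j q * x j q)"
        using linear_within_diff[OF subspace_tangent_space[OF A] metric_linear[OF qA ET[OF i q1]] XT YT]
          expand[OF q1 i] by (simp add: b_def)
      then show "g (f q) (X q - ?Y q) (E i q) = 0"
        using sol[OF q i] metric_sym[OF qA dT ET[OF i q1]] by simp
    qed
  qed
  ultimately show ?thesis
    using U V1(4) by blast
qed

end

section \<open>Screen distributions of lightlike hypersurfaces\<close>

locale screen_hypersurface = metric_map A B f g
  for A :: "('m::{t2_space, second_countable_topology}, 'e::euclidean_space) chart set"
    and B :: "('n::{t2_space, second_countable_topology}, 'f::euclidean_space) chart set"
    and f :: "'n \<Rightarrow> 'm"
    and g :: "'m \<Rightarrow> ('m, 'e) tvec \<Rightarrow> ('m, 'e) tvec \<Rightarrow> real" +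
  fixes S :: "'n \<Rightarrow> ('m, 'e) tvec set"
  assumes lightlike: "lightlike_hypersurface B A g f"
    and screen: "screen_distribution B A g f S"
begin

lemma perp_subbundle: "subbundle B A f 1 (TM_perp B A g f)"
  using lightlike unfolding lightlike_hypersurface_def by blast

lemma S_subspace: "p \<in> carrier B \<Longrightarrow> subspace (S p)"
  and S_tangent: "p \<in> carrier B \<Longrightarrow> S p \<subseteq> tangent_space A (f p)"
  using screen subbundle_fibre unfolding screen_distribution_def by blast+

lemma S_nondegenerate: "p \<in> carrier B \<Longrightarrow> nondegenerate_on (g (f p)) (S p)"
  using screen unfolding screen_distribution_def by blast

lemma TM_eq:
  assumes "p \<in> carrier B"
  shows "TM B A f p = sum_space (S p) (TM_perp B A g f p)"
proof -
  have "orth_direct_sum (g (f p)) (TM B A f p) (S p) (TM_perp B A g f p)"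
    using screen assms unfolding screen_distribution_def by blast
  then show ?thesis
    unfolding orth_direct_sum_def by (rule conjunct1)
qed

lemma TM_perp_subspace: "p \<in> carrier B \<Longrightarrow> subspace (TM_perp B A g f p)"
  and TM_perp_tangent: "p \<in> carrier B \<Longrightarrow> TM_perp B A g f p \<subseteq> tangent_space A (f p)"
  using subbundle_fibre[OF perp_subbundle] by blast+

lemma S_le_TM: "p \<in> carrier B \<Longrightarrow> S p \<subseteq> TM B A f p"
  using TM_eq subspace_0[OF TM_perp_subspace] unfolding sum_space_def by force

lemma TM_perp_orth: "x \<in> TM_perp B A g f p \<Longrightarrow> z \<in> TM B A f p \<Longrightarrow> g (f p) x z = 0"
  unfolding TM_perp_def orth_def by blast

lemma TM_perp_null:
  assumes "p \<in> carrier B" "x \<in> TM_perp B A g f p" "z \<in> TM_perp B A g f p"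
  shows "g (f p) x z = 0"
  using assms TM_perp_orth lightlike unfolding lightlike_hypersurface_def by blast

lemma TM_perp_multiple:
  assumes p: "p \<in> carrier B" and x: "x \<in> TM_perp B A g f p" "x \<noteq> 0" and y: "y \<in> TM_perp B A g f p"
  obtains c where "y = c *\<^sub>R x"
proof -
  obtain V X where "p \<in> V" and *: "\<And>q. q \<in> V \<Longrightarrow> TM_perp B A g f q = span ((\<lambda>j::nat. X j q) ` {..<1})"
    using subbundle_frame[OF perp_subbundle p] by metis
  then have "TM_perp B A g f p = span {X 0 p}" by (simp add: lessThan_Suc)
  then obtain a b where ab: "x = a *\<^sub>R X 0 p" "y = b *\<^sub>R X 0 p"
    using x y by (auto simp: span_singleton)
  then have "y = (b / a) *\<^sub>R x" using x(2) by auto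
  then show thesis by (rule that)
qed

text \<open>The difference d of the two sides is orthogonal to S, to x and to n. Orthogonality to S
  and x makes it normal to M, hence a multiple of x since the normal bundle has rank 1; pairing with
  n shows that the multiple is 0. No dimension count for the orthogonal complement of S
  enters.\<close>

lemma transversal_frame:
  assumes p: "p \<in> carrier B" and x: "x \<in> TM_perp B A g f p" "x \<noteq> 0"
    and n: "transversal_vec A g f S p x n"
    and y: "y \<in> tangent_space A (f p)" "\<And>z. z \<in> S p \<Longrightarrow> g (f p) y z = 0"
  shows "y = g (f p) y n *\<^sub>R x + g (f p) y x *\<^sub>R n"
proof -
  let ?T = "tangent_space A (f p)" and ?h = "g (f p)"
  note T = subspace_tangent_space[OF A, of "f p"]
  note pA = map_into[OF p]
  have xT: "x \<in> ?T" using x TM_perp_tangent[OF p] by blast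
  have nT: "n \<in> ?T" and nx: "?h x n = 1" and nn: "?h n n = 0" and nS: "\<And>z. z \<in> S p \<Longrightarrow> ?h n z = 0"
    using n unfolding transversal_vec_def by auto
  let ?w = "?h y n *\<^sub>R x + ?h y x *\<^sub>R n"
  let ?d = "y - ?w"
  have wT: "?w \<in> ?T" using xT nT T by (intro subspace_add subspace_scale)
  have dT: "?d \<in> ?T" using y(1) wT T by (intro subspace_diff)
  have d: "?h ?d z = ?h y z - (?h y n * ?h x z + ?h y x * ?h n z)" if z: "z \<in> ?T" for z
  proof -
    note lin = metric_linear_left[OF pA z]
    have "?h ?w z = ?h y n * ?h x z + ?h y x * ?h n z"
      using lin xT nT subspace_scale[OF T] unfolding linear_within_def by simp
    then show ?thesis
      using linear_within_diff[OF T lin y(1) wT] by simp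
  qed
  have dS: "?h ?d z = 0" if z: "z \<in> S p" for z
  proof -
    have "?h x z = 0" "z \<in> ?T"
      using TM_perp_orth[OF x(1)] S_le_TM[OF p] S_tangent[OF p] z by blast+
    then show ?thesis
      using d[of z] y(2)[OF z] nS[OF z] by simp
  qed
  have dx: "?h ?d x = 0"
    using d[OF xT] TM_perp_null[OF p x(1) x(1)] nx metric_sym[OF pA nT xT] by simp
  have dn: "?h ?d n = 0"
    using d[OF nT] nx nn by simp
  have "?h ?d z = 0" if tz: "z \<in> TM B A f p" for z
  proof -
    obtain s t where z: "z = s + t" "s \<in> S p" "t \<in> TM_perp B A g f p"
      using tz unfolding TM_eq[OF p] sum_space_def by blast
    obtain c where c: "t = c *\<^sub>R x" using TM_perp_multiple[OF p x z(3)] by blast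
    have "s \<in> ?T" "t \<in> ?T" using z S_tangent[OF p] TM_perp_tangent[OF p] by blast+
    then have "?h ?d z = ?h ?d s + c *\<^sub>R ?h ?d x"
      using metric_linear[OF pA dT] xT unfolding linear_within_def z(1) by (metis c)
    then show ?thesis using dS[OF z(2)] dx by simp
  qed
  then have "?d \<in> TM_perp B A g f p"
    using dT unfolding TM_perp_def orth_def by blast
  then obtain c where c: "?d = c *\<^sub>R x" using TM_perp_multiple[OF p x] by blast
  then have "c *\<^sub>R ?h x n = 0"
    using dn metric_linear_left[OF pA nT] xT unfolding linear_within_def by metis
  then show ?thesis using c nx by simp
qed

lemma null_pair_exists:
  assumes p: "p \<in> carrier B"
  obtains V \<xi> N where "p \<in> V" "null_pair B A g f S V \<xi> N"
proof -
  obtain V0 X where V0: "open V0" "p \<in> V0" "V0 \<subseteq> carrier B" and X: "smooth_section B A f V0 (X 0)"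
    and span: "\<And>q. q \<in> V0 \<Longrightarrow> TM_perp B A g f q = span {X 0 q}"
    by (rule subbundle_frame[OF perp_subbundle p]) (simp add: lessThan_Suc)
  define \<xi> where "\<xi> = X 0"
  have \<xi>_perp: "\<xi> q \<in> TM_perp B A g f q" if "q \<in> V0" for q
    using span[OF that] by (simp add: \<xi>_def span_base)
  have \<xi>_nz: "\<xi> q \<noteq> 0" if "q \<in> V0" for q
  proof
    assume "\<xi> q = 0"
    then have "dim (TM_perp B A g f q) \<le> card ({} :: ('m, 'e) tvec set)"
      by (intro dim_le_card) (use span[OF that] in \<open>auto simp: \<xi>_def\<close>)
    then show False
      using subbundle_fibre(3)[OF perp_subbundle] that V0(3) by fastforce
  qed
  have \<xi>T: "\<xi> q \<in> tangent_space A (f q)" if "q \<in> V0" for q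
    using \<xi>_perp TM_perp_tangent V0(3) that by blast
  \<comment> \<open>Nondegeneracy of the ambient metric supplies a partner for the nonzero vector
    \<xi> p; it is necessarily transversal to M.\<close>
  obtain v where v: "v \<in> tangent_space A (f p)" "g (f p) (\<xi> p) v \<noteq> 0"
    using metric map_into[OF p] \<xi>T[OF V0(2)] \<xi>_nz[OF V0(2)]
    unfolding indefinite_metric_def nondegenerate_on_def by blast
  obtain c where c: "c \<in> A" "f p \<in> fst c"
    using map_into[OF p] unfolding carrier_def by blast
  define V1 where "V1 = V0 \<inter> f -` fst c"
  have V1: "open V1" "V1 \<subseteq> carrier B" "p \<in> V1" "V1 \<subseteq> V0" "V1 \<subseteq> f -` fst c"
    using open_preimage[OF V0(1,3) c(1)] V0 c(2) by (auto simp: V1_def)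
  \<comment> \<open>Constant components in the chart c extend v to a smooth field near p.\<close>
  define Z where "Z q = coord_vec A c (f q) (v c)" for q
  have Z: "smooth_section B A f V1 Z"
    using smooth_section_coord_vec[OF V1(1,2,5) c(1)] by (simp add: Z_def[abs_def])
  have Zp: "Z p = v"
    using tangent_space_eq_coord_vec[OF v(1) c] by (simp add: Z_def)
  obtain r where "subbundle B A f r S"
    using screen unfolding screen_distribution_def by blast
  from smooth_projection[OF this S_nondegenerate V1(1-3) Z]
  obtain U Y where U: "open U" "p \<in> U" "U \<subseteq> V1" and Y: "smooth_section B A f U Y"
    and YS: "\<And>q. q \<in> U \<Longrightarrow> Y q \<in> S q"
    and Yorth: "\<And>q z. q \<in> U \<Longrightarrow> z \<in> S q \<Longrightarrow> g (f q) (Z q - Y q) z = 0"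
    by auto
  have UB: "U \<subseteq> carrier B" "U \<subseteq> V0" using U V1 by auto
  define w where "w q = Z q - Y q" for q
  have w: "smooth_section B A f U w"
    using smooth_section_diff[OF U(1) UB(1) smooth_section_subset[OF Z U(3)] Y] by (simp add: w_def[abs_def])
  have \<xi>: "smooth_section B A f U \<xi>"
    using smooth_section_subset[OF X UB(2)] by (simp add: \<xi>_def)
  define h where "h q = g (f q) (\<xi> q) (w q)" for q
  have h: "smooth_fun B U h"
    using smooth_fun_metric[OF U(1) UB(1) \<xi> w] by (simp add: h_def[abs_def])
  define V where "V = {q \<in> U. h q \<noteq> 0}"
  have V: "open V" "V \<subseteq> U" "V \<subseteq> carrier B"
    using smooth_fun_nonzero_open[OF B U(1) UB(1) h] UB(1) by (auto simp: V_def)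
  \<comment> \<open>Removing the screen part does not change the pairing with \<xi>, because Y lies
    in S and so is tangent to M; hence h p = g(\<xi> p, v) is nonzero.\<close>
  have "h p = g (f p) (\<xi> p) (Z p) - g (f p) (\<xi> p) (Y p)"
    unfolding h_def w_def
    using linear_within_diff[OF subspace_tangent_space[OF A] metric_linear[OF map_into[OF p] \<xi>T[OF V0(2)]]]
      smooth_section_tangent[OF Z V1(3)] smooth_section_tangent[OF Y U(2)] by blast
  moreover have "g (f p) (\<xi> p) (Y p) = 0"
    using TM_perp_orth[OF \<xi>_perp[OF V0(2)]] S_le_TM[OF p] YS[OF U(2)] by blast
  ultimately have pV: "p \<in> V"
    using v(2) Zp U(2) by (simp add: V_def)
  \<comment> \<open>Dividing by h normalises the pairing with \<xi>. For w/h + t \<xi> the square is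
    g(w, w)/h^2 + 2 t, since \<xi> is null; this fixes t = -g(w, w)/(2 h^2). Adding a multiple of
    \<xi> spoils neither the normalisation nor orthogonality to S.\<close>
  define N where "N q = (1 / h q) *\<^sub>R w q - (g (f q) (w q) (w q) / (2 * (h q * h q))) *\<^sub>R \<xi> q" for q
  have smw: "smooth_section B A f V w" and sm\<xi>: "smooth_section B A f V \<xi>" and smh: "smooth_fun B V h"
    using w \<xi> h V(2) smooth_section_subset smooth_fun_subset by blast+
  have h_nz: "h q \<noteq> 0" if "q \<in> V" for q using that by (simp add: V_def)
  have "smooth_section B A f V N"
    unfolding N_def[abs_def] using h_nz
    by (intro smooth_section_diff smooth_section_scaleR smooth_fun_divide[OF B] smooth_fun_mult[OF B]
        smooth_fun_const smooth_fun_metric smw sm\<xi> smh V(1,3)) auto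
  moreover have "transversal_vec A g f S q (\<xi> q) (N q)" if q: "q \<in> V" for q
  proof -
    let ?T = "tangent_space A (f q)" and ?h = "g (f q)"
    have qB: "q \<in> carrier B" and qU: "q \<in> U" and q0: "q \<in> V0" using q V UB by auto
    note qA = map_into[OF qB]
    note T = subspace_tangent_space[OF A, of "f q"]
    have wT: "w q \<in> ?T" using smooth_section_tangent[OF smw q] .
    note xT = \<xi>T[OF q0]
    have NT: "N q \<in> ?T"
      unfolding N_def using wT xT T by (intro subspace_diff subspace_scale)
    have lin: "?h z (N q) = (1 / h q) * ?h z (w q) - (?h (w q) (w q) / (2 * (h q * h q))) * ?h z (\<xi> q)"
      if z: "z \<in> ?T" for z
      using linear_within_diff[OF T metric_linear[OF qA z]] metric_linear[OF qA z] wT xT subspace_scale[OF T]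
      unfolding N_def linear_within_def by simp
    have xx: "?h (\<xi> q) (\<xi> q) = 0" using TM_perp_null[OF qB] \<xi>_perp[OF q0] by blast
    have xw: "?h (\<xi> q) (w q) = h q" by (simp add: h_def)
    have xN: "?h (\<xi> q) (N q) = 1"
      using lin[OF xT] xx xw h_nz[OF q] by simp
    have wN: "?h (w q) (N q) = ?h (w q) (w q) / (2 * h q)"
      using lin[OF wT] metric_sym[OF qA wT xT] xw h_nz[OF q] by (simp add: field_simps)
    have NN: "?h (N q) (N q) = 0"
      using lin[OF NT] metric_sym[OF qA NT] wT xT xN wN by (simp add: field_simps)
    have NS: "?h (N q) z = 0" if z: "z \<in> S q" for z
    proof -
      have zT: "z \<in> ?T" using z S_tangent[OF qB] by blast
      have "?h z (w q) = 0"
        using Yorth[OF qU z] metric_sym[OF qA zT wT] by (simp add: w_def)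
      moreover have "?h z (\<xi> q) = 0"
        using TM_perp_orth[OF \<xi>_perp[OF q0]] S_le_TM[OF qB] z metric_sym[OF qA zT xT] by auto
      ultimately show ?thesis
        using lin[OF zT] metric_sym[OF qA zT NT] by simp
    qed
    show ?thesis
      using NT xN NN NS unfolding transversal_vec_def by blast
  qed
  ultimately have "null_pair B A g f S V \<xi> N"
    unfolding null_pair_def using V UB sm\<xi> \<xi>_perp \<xi>_nz by blast
  with pV show thesis by (rule that)
qed

section \<open>The screen component of the structure vector field\<close>

lemma tr_TM_orth:
  assumes p: "p \<in> carrier B" and n: "n \<in> tr_TM B A g f S p"
  shows "n \<in> orth (g (f p)) (tangent_space A (f p)) (S p)"
proof -
  have "{n. \<exists>x\<in>TM_perp B A g f p. x \<noteq> 0 \<and> transversal_vec A g f S p x n}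
      \<subseteq> orth (g (f p)) (tangent_space A (f p)) (S p)"
    unfolding transversal_vec_def orth_def by blast
  from span_minimal[OF this subspace_orth[OF map_into[OF p] S_tangent[OF p]]] n show ?thesis
    unfolding tr_TM_def by (rule subsetD)
qed

lemma TM_perp_le_orth_S:
  assumes p: "p \<in> carrier B"
  shows "TM_perp B A g f p \<subseteq> orth (g (f p)) (tangent_space A (f p)) (S p)"
  using S_le_TM[OF p] unfolding TM_perp_def orth_def by blast

lemma orth_S_disjoint:
  assumes "p \<in> carrier B" "x \<in> S p" "x \<in> orth (g (f p)) (tangent_space A (f p)) (S p)"
  shows "x = 0"
  using assms S_nondegenerate unfolding nondegenerate_on_def orth_def by blast

text \<open>Replaces the definite description by an orthogonality criterion. Existence:
  \<open>transversal_frame\<close> for a local pair splits \<zeta> - Y into multiples of \<xi> and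
  N. Uniqueness: the sum of \<open>TM_perp\<close> and \<open>tr_TM\<close> is orthogonal to S, so
  two candidates differ by an element of S orthogonal to S, which is 0.\<close>

lemma W_part_eqI:
  assumes p: "p \<in> carrier B" and Y: "Y \<in> S p"
    and orth: "\<zeta> (f p) - Y \<in> orth (g (f p)) (tangent_space A (f p)) (S p)"
  shows "W_part B A \<zeta> g f S p = Y"
  unfolding W_part_def component_def
proof (rule the_equality)
  let ?O = "orth (g (f p)) (tangent_space A (f p)) (S p)"
  let ?F = "sum_space (TM_perp B A g f p) (tr_TM B A g f S p)"
  obtain V \<xi> N where pV: "p \<in> V" and N: "null_pair B A g f S V \<xi> N"
    using null_pair_exists[OF p] .
  then have \<xi>: "\<xi> p \<in> TM_perp B A g f p" "\<xi> p \<noteq> 0" and n: "transversal_vec A g f S p (\<xi> p) (N p)"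
    unfolding null_pair_def by auto
  let ?y = "\<zeta> (f p) - Y"
  have "?y = g (f p) ?y (N p) *\<^sub>R \<xi> p + g (f p) ?y (\<xi> p) *\<^sub>R N p"
    by (rule transversal_frame[OF p \<xi> n]) (use orth in \<open>auto simp: orth_def\<close>)
  moreover have "g (f p) ?y (N p) *\<^sub>R \<xi> p \<in> TM_perp B A g f p"
    using \<xi>(1) subspace_scale[OF TM_perp_subspace[OF p]] by blast
  moreover have "N p \<in> tr_TM B A g f S p"
    unfolding tr_TM_def using \<xi> n by (intro span_base) blast
  then have "g (f p) ?y (\<xi> p) *\<^sub>R N p \<in> tr_TM B A g f S p"
    unfolding tr_TM_def by (rule span_scale)
  ultimately have "?y \<in> ?F"
    unfolding sum_space_def by blast
  then show "Y \<in> S p \<and> (\<exists>y\<in>?F. \<zeta> (f p) = Y + y)"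
    using Y by (intro conjI bexI[of _ ?y]) auto
  fix x assume "x \<in> S p \<and> (\<exists>y\<in>?F. \<zeta> (f p) = x + y)"
  then obtain s t where x: "x \<in> S p" and st: "s \<in> TM_perp B A g f p" "t \<in> tr_TM B A g f S p"
    "\<zeta> (f p) = x + (s + t)" unfolding sum_space_def by blast
  note O = subspace_orth[OF map_into[OF p] S_tangent[OF p]]
  have "s + t \<in> ?O"
    using st tr_TM_orth[OF p] TM_perp_le_orth_S[OF p] O by (intro subspace_add) auto
  then have "?y - (s + t) \<in> ?O" using subspace_diff[OF O orth] by blast
  then have "x - Y \<in> ?O" using st(3) by (simp add: algebra_simps)
  moreover have "x - Y \<in> S p" using x Y S_subspace[OF p] by (intro subspace_diff)
  ultimately show "x = Y" using orth_S_disjoint[OF p] by fastforce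
qed

text \<open>The smooth projection of \<zeta> onto S meets the criterion \<open>W_part_eqI\<close>
  throughout U, so it is \<open>W_part\<close> there. The two conditions of the criterion are
  returned as well, because all later arguments use them in place of the definite
  description.\<close>

lemma W_part_smooth_local:
  assumes \<zeta>: "vector_field A \<zeta>" and p: "p \<in> carrier B"
  obtains U where "open U" "p \<in> U" "U \<subseteq> carrier B" "smooth_section B A f U (W_part B A \<zeta> g f S)"
    "\<And>q. q \<in> U \<Longrightarrow> W_part B A \<zeta> g f S q \<in> S q"
    "\<And>q. q \<in> U \<Longrightarrow> \<zeta> (f q) - W_part B A \<zeta> g f S q \<in> orth (g (f q)) (tangent_space A (f q)) (S q)"
proof -
  \<comment> \<open>The pair serves to supply an open neighbourhood of p inside the carrier.\<close>
  obtain V where V: "open V" "V \<subseteq> carrier B" "p \<in> V"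
    using null_pair_exists[OF p] unfolding null_pair_def by metis
  note Z = smooth_section_pullback[OF \<zeta> V(1,2)]
  obtain r where "subbundle B A f r S"
    using screen unfolding screen_distribution_def by blast
  from smooth_projection[OF this S_nondegenerate V Z]
  obtain U Y where U: "open U" "p \<in> U" "U \<subseteq> V" and Y: "smooth_section B A f U Y"
    and YS: "\<And>q. q \<in> U \<Longrightarrow> Y q \<in> S q"
    and Yorth: "\<And>q z. q \<in> U \<Longrightarrow> z \<in> S q \<Longrightarrow> g (f q) (\<zeta> (f q) - Y q) z = 0"
    by auto
  have UB: "U \<subseteq> carrier B" using U V by blast
  have orth: "\<zeta> (f q) - Y q \<in> orth (g (f q)) (tangent_space A (f q)) (S q)" if "q \<in> U" for q
  proof -
    have "\<zeta> (f q) \<in> tangent_space A (f q)" "Y q \<in> tangent_space A (f q)"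
      using smooth_section_tangent[OF Z] smooth_section_tangent[OF Y that] that U(3) by blast+
    then show ?thesis
      using Yorth[OF that] subspace_diff[OF subspace_tangent_space[OF A]] unfolding orth_def by blast
  qed
  have W: "W_part B A \<zeta> g f S q = Y q" if "q \<in> U" for q
    using W_part_eqI YS orth that UB by blast
  have "smooth_section B A f U (W_part B A \<zeta> g f S)"
    by (rule smooth_section_cong[OF U(1) UB _ Y]) (simp add: W)
  then show thesis
    by (rule that[OF U(1,2) UB]) (simp_all only: W YS orth)
qed

end

section \<open>The structure vector field\<close>

text \<open>Everything rests on \<phi> \<zeta> = 0. Compatibility of g with second argument \<zeta>
  then reads 0 = g(x, \<zeta>) - \<eta>(x), and bracketing a triple application of \<phi> to x in
  two ways gives \<eta>(\<phi> x) \<zeta> = 0.\<close>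

lemma almost_contact_eta:
  assumes C: "indefinite_almost_contact_metric A \<phi> \<zeta> \<eta> g" and p: "p \<in> carrier A"
    and x: "x \<in> tangent_space A p"
  shows "\<eta> p x = g p x (\<zeta> p)" and "\<eta> p (\<phi> p x) = 0"
proof -
  let ?T = "tangent_space A p"
  have A: "smooth_atlas A" using C unfolding indefinite_almost_contact_metric_def by blast
  note T = subspace_tangent_space[OF A, of p]
  have \<zeta>T: "\<zeta> p \<in> ?T"
    using C p unfolding indefinite_almost_contact_metric_def vector_field_def smooth_section_def by blast
  have \<phi>: "linear_within ?T (\<phi> p)" and \<phi>T: "\<And>y. y \<in> ?T \<Longrightarrow> \<phi> p y \<in> ?T"
    using C p unfolding indefinite_almost_contact_metric_def tensor_field_1_1_def by blast+
  have \<eta>: "linear_within ?T (\<eta> p)"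
    using C p unfolding indefinite_almost_contact_metric_def one_form_def by blast
  have \<eta>\<zeta>: "\<eta> p (\<zeta> p) = 1"
    and \<phi>\<phi>: "\<And>y. y \<in> ?T \<Longrightarrow> \<phi> p (\<phi> p y) = - y + \<eta> p y *\<^sub>R \<zeta> p"
    and g\<phi>: "\<And>y z. y \<in> ?T \<Longrightarrow> z \<in> ?T \<Longrightarrow> g p (\<phi> p y) (\<phi> p z) = g p y z - \<eta> p y * \<eta> p z"
    using C p unfolding indefinite_almost_contact_metric_def by blast+
  have \<zeta>_nz: "\<zeta> p \<noteq> 0"
    using \<eta>\<zeta> linear_within_0[OF T \<eta>] by auto
  have \<phi>\<phi>\<zeta>: "\<phi> p (\<phi> p (\<zeta> p)) = 0"
    using \<phi>\<phi>[OF \<zeta>T] \<eta>\<zeta> by simp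
  \<comment> \<open>As \<phi>(\<phi> \<zeta>) = 0, the formula for the square of \<phi>, taken at
    \<phi> \<zeta>, yields \<phi> \<zeta> = c \<zeta>; applying \<phi> once more gives 0 = c^2
    \<zeta>, so c = 0.\<close>
  define c where "c = \<eta> p (\<phi> p (\<zeta> p))"
  have "- \<phi> p (\<zeta> p) + c *\<^sub>R \<zeta> p = 0"
    using \<phi>\<phi>[OF \<phi>T[OF \<zeta>T]] \<phi>\<phi>\<zeta> linear_within_0[OF T \<phi>] by (simp add: c_def)
  then have \<phi>\<zeta>: "\<phi> p (\<zeta> p) = c *\<^sub>R \<zeta> p"
    by (simp add: neg_eq_iff_add_eq_0[symmetric] del: neg_eq_iff_add_eq_0)
  then have "\<phi> p (\<phi> p (\<zeta> p)) = c *\<^sub>R \<phi> p (\<zeta> p)"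
    using \<phi> \<zeta>T unfolding linear_within_def by metis
  then have "c = 0"
    using \<phi>\<phi>\<zeta> \<phi>\<zeta> \<zeta>_nz by simp
  with \<phi>\<zeta> have \<phi>\<zeta>: "\<phi> p (\<zeta> p) = 0" by simp
  have metric: "linear_within ?T (g p y)" if "y \<in> ?T" for y
    using C p that unfolding indefinite_almost_contact_metric_def indefinite_metric_def by blast
  show "\<eta> p x = g p x (\<zeta> p)"
    using g\<phi>[OF x \<zeta>T] \<phi>\<zeta> \<eta>\<zeta> linear_within_0[OF T metric[OF \<phi>T[OF x]]] by simp
  have "\<phi> p (- x + \<eta> p x *\<^sub>R \<zeta> p) = - \<phi> p x"
  proof -
    have "\<phi> p ((-1) *\<^sub>R x + \<eta> p x *\<^sub>R \<zeta> p) = (-1) *\<^sub>R \<phi> p x + \<eta> p x *\<^sub>R \<phi> p (\<zeta> p)"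
      using \<phi> x \<zeta>T subspace_scale[OF T] unfolding linear_within_def by metis
    then show ?thesis using \<phi>\<zeta> by simp
  qed
  then have "- \<phi> p x + \<eta> p (\<phi> p x) *\<^sub>R \<zeta> p = - \<phi> p x"
    using \<phi>\<phi>[OF x] \<phi>\<phi>[OF \<phi>T[OF x]] by simp
  then show "\<eta> p (\<phi> p x) = 0" using \<zeta>_nz by simp
qed

context screen_hypersurface
begin

text \<open>Let u be the part of W in \<open>phi_part\<close>. Both W and its part in D' are
  orthogonal to \<open>phi_part\<close>, hence so is u; being also orthogonal to D', it is
  orthogonal to all of S and vanishes by nondegeneracy of S.\<close>

lemma W_part_in_D':
  assumes C: "indefinite_almost_contact_metric A \<phi> \<zeta> \<eta> g"
    and D': "adapted_screen B A \<phi> g f S D'" and p: "p \<in> carrier B"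
    and WS: "W_part B A \<zeta> g f S p \<in> S p"
    and W: "\<zeta> (f p) - W_part B A \<zeta> g f S p \<in> orth (g (f p)) (tangent_space A (f p)) (S p)"
  shows "W_part B A \<zeta> g f S p \<in> D' p" and "W'_part B A \<phi> \<zeta> g f S D' p = W_part B A \<zeta> g f S p"
proof -
  let ?T = "tangent_space A (f p)" and ?h = "g (f p)" and ?W = "W_part B A \<zeta> g f S p"
  let ?P = "phi_part B A \<phi> g f S p"
  note pA = map_into[OF p]
  note T = subspace_tangent_space[OF A, of "f p"]
  have sum: "orth_direct_sum ?h (S p) ?P (D' p)"
    using D' p unfolding adapted_screen_def by blast
  have Seq: "S p = sum_space ?P (D' p)" and PD: "\<And>x y. x \<in> ?P \<Longrightarrow> y \<in> D' p \<Longrightarrow> ?h x y = 0"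
    using sum unfolding orth_direct_sum_def by auto
  have 0: "0 \<in> ?P" "0 \<in> D' p" using sum unfolding orth_direct_sum_def by auto
  have PDS: "x + y \<in> S p" if "x \<in> ?P" "y \<in> D' p" for x y
    using that unfolding Seq sum_space_def by blast
  have PS: "?P \<subseteq> S p" and DS: "D' p \<subseteq> S p"
    using PDS[OF _ 0(2)] PDS[OF 0(1)] by auto
  have ST: "S p \<subseteq> ?T" using S_tangent[OF p] .
  have \<zeta>T: "\<zeta> (f p) \<in> ?T"
    using C pA unfolding indefinite_almost_contact_metric_def vector_field_def smooth_section_def by blast
  have \<phi>: "linear_within ?T (\<phi> (f p))"
    using C pA unfolding indefinite_almost_contact_metric_def tensor_field_1_1_def by blast
  have WP: "?h ?W v = 0" if v: "v \<in> ?P" for v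
  proof -
    obtain x n where xn: "x \<in> TM_perp B A g f p" "n \<in> tr_TM B A g f S p" "v = \<phi> (f p) x + \<phi> (f p) n"
      using v unfolding phi_part_def sum_space_def by blast
    have xT: "x \<in> ?T" using xn(1) TM_perp_tangent[OF p] by blast
    have nT: "n \<in> ?T" using tr_TM_orth[OF p xn(2)] unfolding orth_def by blast
    \<comment> \<open>Linearity merges the two images, so one use of \<eta> \<circ> \<phi> = 0
      covers a general element of \<open>phi_part\<close>.\<close>
    have v_eq: "v = \<phi> (f p) (x + n)"
      using \<phi> xT nT xn(3) unfolding linear_within_def by simp
    have vS: "v \<in> S p" using v PS by blast
    then have vT: "v \<in> ?T" using ST by blast
    have "?h v (\<zeta> (f p)) = 0"
      using almost_contact_eta(1)[OF C pA vT] almost_contact_eta(2)[OF C pA subspace_add[OF T xT nT]] v_eq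
      by simp
    then have "?h (\<zeta> (f p)) v = 0" using metric_sym[OF pA vT \<zeta>T] by simp
    moreover have "?h (\<zeta> (f p) - ?W) v = 0" using W vS unfolding orth_def by blast
    ultimately show ?thesis
      using linear_within_diff[OF T metric_linear_left[OF pA vT] \<zeta>T, of ?W] WS ST by auto
  qed
  \<comment> \<open>Stated for an arbitrary splitting of W, this gives both the membership of W in
    D' and the uniqueness demanded by \<open>component\<close>.\<close>
  have zero: "u = 0" if u: "u \<in> ?P" and w: "w \<in> D' p" and uw: "?W = u + w" for u w
  proof -
    have uT: "u \<in> ?T" and wT: "w \<in> ?T" using u w PS DS ST by auto
    have uP: "?h u v = 0" if v: "v \<in> ?P" for v
    proof -
      have vT: "v \<in> ?T" using v PS ST by blast
      have "?h u v + ?h w v = 0"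
        using WP[OF v] metric_linear_left[OF pA vT] uT wT unfolding uw linear_within_def by simp
      then show ?thesis using PD[OF v w] metric_sym[OF pA wT vT] by simp
    qed
    have "?h u z = 0" if z: "z \<in> S p" for z
    proof -
      obtain v d where vd: "v \<in> ?P" "d \<in> D' p" "z = v + d"
        using z unfolding Seq sum_space_def by blast
      have "v \<in> ?T" "d \<in> ?T" using vd PS DS ST by auto
      then have "?h u z = ?h u v + ?h u d"
        using metric_linear[OF pA uT] vd(3) unfolding linear_within_def by simp
      then show ?thesis using uP[OF vd(1)] PD[OF u vd(2)] by simp
    qed
    then show "u = 0"
      using S_nondegenerate[OF p] u PS unfolding nondegenerate_on_def by blast
  qed
  show WD: "?W \<in> D' p"
    using WS zero unfolding Seq sum_space_def by force
  show "W'_part B A \<phi> \<zeta> g f S D' p = ?W"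
    unfolding W'_part_def component_def
  proof (rule the_equality)
    show "?W \<in> D' p \<and> (\<exists>y\<in>?P. ?W = ?W + y)" using WD 0 by auto
    fix x assume "x \<in> D' p \<and> (\<exists>y\<in>?P. ?W = x + y)"
    then obtain y where "x \<in> D' p" "y \<in> ?P" "?W = y + x" by (auto simp: add.commute)
    then show "x = ?W" using zero by fastforce
  qed
qed

end

theorem theorem3p5:
  fixes A :: "('m::{t2_space, second_countable_topology}, 'e::euclidean_space) chart set"
    and \<phi> :: "'m \<Rightarrow> ('m, 'e) tvec \<Rightarrow> ('m, 'e) tvec"
    and \<zeta> :: "'m \<Rightarrow> ('m, 'e) tvec"
    and \<eta> :: "'m \<Rightarrow> ('m, 'e) tvec \<Rightarrow> real"
    and g :: "'m \<Rightarrow> ('m, 'e) tvec \<Rightarrow> ('m, 'e) tvec \<Rightarrow> real"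
    and B :: "('n::{t2_space, second_countable_topology}, 'f::euclidean_space) chart set"
    and f :: "'n \<Rightarrow> 'm"
    and S D' :: "'n \<Rightarrow> ('m, 'e) tvec set"
  assumes "indefinite_almost_contact_metric A \<phi> \<zeta> \<eta> g"
    and "lightlike_hypersurface B A g f"
    and "screen_distribution B A g f S"
    and "adapted_screen B A \<phi> g f S D'"
  defines "form1 \<equiv> \<forall>V \<xi> N. null_pair B A g f S V \<xi> N \<longrightarrow>
      (\<forall>p\<in>V. \<zeta> (f p) = \<eta> (f p) (N p) *\<^sub>R \<xi> p + \<eta> (f p) (\<xi> p) *\<^sub>R N p)"
    and "W' \<equiv> W'_part B A \<phi> \<zeta> g f S D'"
  defines "form2 \<equiv> section_of B A f D' W' \<and> (\<exists>p\<in>carrier B. W' p \<noteq> 0) \<and>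
      (\<forall>V \<xi> N. null_pair B A g f S V \<xi> N \<longrightarrow>
        (\<forall>p\<in>V. \<zeta> (f p) = W' p + \<eta> (f p) (N p) *\<^sub>R \<xi> p + \<eta> (f p) (\<xi> p) *\<^sub>R N p))"
  shows "(form1 \<or> form2) \<and> \<not> (form1 \<and> form2) \<and> (form1 \<longleftrightarrow> ascreen B A \<zeta> g f S)"
proof -
  note C = assms(1)
  have A: "smooth_atlas A" and metric: "indefinite_metric A g" and \<zeta>: "vector_field A \<zeta>"
    using C unfolding indefinite_almost_contact_metric_def by blast+
  have B: "smooth_atlas B" and f: "smooth_map B A f"
    using assms(2) unfolding lightlike_hypersurface_def hypersurface_def immersion_def by blast+
  interpret screen_hypersurface A B f g S
    by unfold_locales (fact A B f metric assms(2,3))+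
  have pointwise: "W_part B A \<zeta> g f S p \<in> S p"
      "\<zeta> (f p) - W_part B A \<zeta> g f S p \<in> orth (g (f p)) (tangent_space A (f p)) (S p)"
    if "p \<in> carrier B" for p
    using W_part_smooth_local[OF \<zeta> that] by metis+
  have W'D: "W' p \<in> D' p" and W'_eq: "W' p = W_part B A \<zeta> g f S p" if "p \<in> carrier B" for p
    using W_part_in_D'[OF C assms(4) that pointwise[OF that]] by (simp_all add: W'_def)
  have W'S: "W' p \<in> S p"
    and W'_orth: "\<zeta> (f p) - W' p \<in> orth (g (f p)) (tangent_space A (f p)) (S p)"
    if "p \<in> carrier B" for p
    using pointwise[OF that] W'_eq[OF that] by simp_all
  have "smooth_section B A f (carrier B) W'"
  proof (rule smooth_section_local)
    fix p assume "p \<in> carrier B"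
    then obtain U where U: "open U" "p \<in> U" "U \<subseteq> carrier B" "smooth_section B A f U (W_part B A \<zeta> g f S)"
      using W_part_smooth_local[OF \<zeta>] by metis
    moreover have "smooth_section B A f U W'"
      by (rule smooth_section_cong[OF U(1,3) _ U(4)]) (use W'_eq U(3) in auto)
    ultimately show "\<exists>U. open U \<and> p \<in> U \<and> U \<subseteq> carrier B \<and> smooth_section B A f U W'"
      by blast
  qed simp
  then have W'_section: "section_of B A f D' W'"
    unfolding section_of_def using W'D by blast
  have decomp: "\<zeta> (f p) = W' p + \<eta> (f p) (N p) *\<^sub>R \<xi> p + \<eta> (f p) (\<xi> p) *\<^sub>R N p"
    if N: "null_pair B A g f S V \<xi> N" and pV: "p \<in> V" for V \<xi> N p
  proof -
    have p: "p \<in> carrier B" and \<xi>: "\<xi> p \<in> TM_perp B A g f p" "\<xi> p \<noteq> 0"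
      and n: "transversal_vec A g f S p (\<xi> p) (N p)"
      using N pV unfolding null_pair_def by blast+
    let ?T = "tangent_space A (f p)"
    note pA = map_into[OF p]
    have \<zeta>T: "\<zeta> (f p) \<in> ?T"
      using \<zeta> pA unfolding vector_field_def smooth_section_def by blast
    have WT: "W' p \<in> ?T" using W'S[OF p] S_tangent[OF p] by blast
    have \<xi>T: "\<xi> p \<in> ?T" using \<xi> TM_perp_tangent[OF p] by blast
    have NT: "N p \<in> ?T" using n unfolding transversal_vec_def by blast
    \<comment> \<open>On vectors orthogonal to W', pairing with \<zeta> - W' is pairing with
      \<zeta>, which is \<eta>. For N and \<xi> this identifies the coefficients of
      \<open>transversal_frame\<close> with \<eta>(N) and \<eta>(\<xi>).\<close>
    have diff: "g (f p) (\<zeta> (f p) - W' p) x = \<eta> (f p) x" if x: "x \<in> ?T" "g (f p) x (W' p) = 0" for x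
      using linear_within_diff[OF subspace_tangent_space[OF A] metric_linear_left[OF pA x(1)] \<zeta>T WT]
        metric_sym[OF pA x(1)] \<zeta>T WT x(2) almost_contact_eta(1)[OF C pA x(1)] by simp
    have "g (f p) (\<zeta> (f p) - W' p) (\<xi> p) = \<eta> (f p) (\<xi> p)"
      by (rule diff[OF \<xi>T]) (use TM_perp_orth[OF \<xi>(1)] S_le_TM[OF p] W'S[OF p] in blast)
    moreover have "g (f p) (\<zeta> (f p) - W' p) (N p) = \<eta> (f p) (N p)"
      by (rule diff[OF NT]) (use n W'S[OF p] in \<open>simp add: transversal_vec_def\<close>)
    moreover have "\<zeta> (f p) - W' p = g (f p) (\<zeta> (f p) - W' p) (N p) *\<^sub>R \<xi> p +
        g (f p) (\<zeta> (f p) - W' p) (\<xi> p) *\<^sub>R N p"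
      by (rule transversal_frame[OF p \<xi> n]) (use W'_orth[OF p] in \<open>auto simp: orth_def\<close>)
    ultimately have "\<zeta> (f p) - W' p = \<eta> (f p) (N p) *\<^sub>R \<xi> p + \<eta> (f p) (\<xi> p) *\<^sub>R N p" by simp
    then show ?thesis by (simp add: algebra_simps)
  qed
  have form1_iff: "form1 \<longleftrightarrow> (\<forall>p\<in>carrier B. W' p = 0)"
  proof
    assume F: form1
    show "\<forall>p\<in>carrier B. W' p = 0"
    proof
      fix p assume p: "p \<in> carrier B"
      \<comment> \<open>Without a pair around p, \<open>form1\<close> would say nothing at
        p.\<close>
      obtain V \<xi> N where "p \<in> V" "null_pair B A g f S V \<xi> N" using null_pair_exists[OF p] .
      then have "\<zeta> (f p) = W' p + (\<eta> (f p) (N p) *\<^sub>R \<xi> p + \<eta> (f p) (\<xi> p) *\<^sub>R N p)"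
        and "\<zeta> (f p) = \<eta> (f p) (N p) *\<^sub>R \<xi> p + \<eta> (f p) (\<xi> p) *\<^sub>R N p"
        using decomp[of V \<xi> N p] F by (auto simp: form1_def add.assoc)
      then show "W' p = 0" by simp
    qed
  next
    assume 0: "\<forall>p\<in>carrier B. W' p = 0"
    show form1
      unfolding form1_def
    proof (intro allI impI ballI)
      fix V \<xi> N p assume *: "null_pair B A g f S V \<xi> N" "p \<in> V"
      then have "W' p = 0" using 0 unfolding null_pair_def by blast
      then show "\<zeta> (f p) = \<eta> (f p) (N p) *\<^sub>R \<xi> p + \<eta> (f p) (\<xi> p) *\<^sub>R N p"
        using decomp[OF *] by simp
    qed
  qed
  \<comment> \<open>The section property and the decomposition hold for W' in every case, so
    \<open>form2\<close> reduces to W' being nonzero somewhere.\<close>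
  have form2_iff: "form2 \<longleftrightarrow> (\<exists>p\<in>carrier B. W' p \<noteq> 0)"
    unfolding form2_def using W'_section decomp by blast
  have "ascreen B A \<zeta> g f S \<longleftrightarrow> (\<forall>p\<in>carrier B. W' p = 0)"
    unfolding ascreen_def
  proof (intro ball_cong refl iffI)
    fix p assume p: "p \<in> carrier B"
    let ?O = "orth (g (f p)) (tangent_space A (f p)) (S p)"
    note O = subspace_orth[OF map_into[OF p] S_tangent[OF p]]
    show "\<zeta> (f p) \<in> ?O" if "W' p = 0" using W'_orth[OF p] that by simp
    assume "\<zeta> (f p) \<in> ?O"
    \<comment> \<open>W' is a difference of two vectors orthogonal to S and itself lies in S, which
      is nondegenerate.\<close>
    then have "\<zeta> (f p) - (\<zeta> (f p) - W' p) \<in> ?O"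
      using subspace_diff[OF O] W'_orth[OF p] by blast
    then show "W' p = 0" using orth_S_disjoint[OF p W'S[OF p]] by simp
  qed
  with form1_iff form2_iff show ?thesis by blast
qed

end
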